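(* Assume the weak form of the $abc$ conjecture holds: there is a constant $\kappa_1>0$ such that for every $\epsilon>0$ there are only finitely many primitive integer solutions $(A,B,C)$ of $A+B=C$ with $R(A,B,C)\le H(A,B,C)^{\kappa_1-\epsilon}$. Then for any $\epsilon>0$ there are only finitely many primitive integer solutions $(X,Y,Z)$ of $X+Y=Z$ such that \[ S(X,Y,Z)\le (\kappa_1-\epsilon)\log H(X,Y,Z). \] In particular the $xyz$-smoothness exponent satisfies $\kappa_0\ge\kappa_1$.
   Context: An integer solution $(X,Y,Z)$ of $X+Y=Z$ is primitive if $\gcd(X,Y,Z)=1$; solutions are taken nondegenerate ($XYZ\neq 0$). Height: $H(X,Y,Z)=\max(|X|,|Y|,|Z|)$. Radical: $R(X,Y,Z)=\prod_{p\mid XYZ}p$. Smoothness: $S(X,Y,Z)=\max\{p \text{ prime}: p\mid XYZ\}$. The $xyz$-smoothness exponent is \[ \kappa_0=\liminf_{H(X,Y,Z)\to\infty,\ X+Y=Z,\ \gcd(X,Y,Z)=1}\frac{\log S(X,Y,Z)}{\log\log H(X,Y,Z)}\in[0,\infty]. \] *)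

theory Defs
  imports
    "HOL-Analysis.Analysis"
    "HOL-Computational_Algebra.Computational_Algebra"
begin

text \<open>
  Primitive nondegenerate integer solutions of \<open>X + Y = Z\<close>. As \<open>X * Y * Z\<close> is nonzero and even
  for these, it has a nonempty finite set of prime divisors.
\<close>
definition primitive_solutions :: "(int \<times> int \<times> int) set" where
  "primitive_solutions =
     {(X, Y, Z). X + Y = Z \<and> gcd X (gcd Y Z) = 1 \<and> X * Y * Z \<noteq> 0}"

fun height :: "int \<times> int \<times> int \<Rightarrow> int" where
  "height (X, Y, Z) = Max {\<bar>X\<bar>, \<bar>Y\<bar>, \<bar>Z\<bar>}"

fun rad :: "int \<times> int \<times> int \<Rightarrow> int" where
  "rad (X, Y, Z) = \<Prod>{p. prime p \<and> p dvd X * Y * Z}"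

fun smoothness :: "int \<times> int \<times> int \<Rightarrow> int" where
  "smoothness (X, Y, Z) = Max {p. prime p \<and> p dvd X * Y * Z}"

definition weak_abc :: "real \<Rightarrow> bool" where
  "weak_abc \<kappa>\<^sub>1 \<longleftrightarrow> \<kappa>\<^sub>1 > 0 \<and>
     (\<forall>\<epsilon>>0. finite {s \<in> primitive_solutions.
        real_of_int (rad s) \<le> real_of_int (height s) powr (\<kappa>\<^sub>1 - \<epsilon>)})"

text \<open>
  The limit inferior is taken over the primitive solutions along \<open>height s \<rightarrow> \<infinity>\<close>; only finitely
  many primitive solutions have bounded height, and the quotient is positive once \<open>height s \<ge> 3\<close>.
\<close>
definition smoothness_exponent :: ereal where
  "smoothness_exponent =
     Liminf (inf (filtercomap height at_top) (principal primitive_solutions))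
       (\<lambda>s. ereal (ln (real_of_int (smoothness s)) / ln (ln (real_of_int (height s)))))"

end

theory Submission
  imports Defs "HOL-Complex_Analysis.Complex_Analysis" "HOL-Number_Theory.Prime_Powers"
begin

text \<open>
  The radical of a solution is at most the product of all primes up to its smoothness \<open>S\<close>, that is
  \<open>exp (\<psi> S)\<close> with Chebyshev's function \<open>\<psi>\<close>. Since the constant \<open>\<kappa>\<^sub>1\<close> has to be preserved exactly,
  the upper half \<open>\<psi> n \<le> (1 + \<epsilon>) n + O(1)\<close> of the prime number theorem is needed; then
  \<open>S \<le> (\<kappa>\<^sub>1 - \<epsilon>) ln H\<close> implies \<open>R \<le> H powr (\<kappa>\<^sub>1 - \<epsilon> / 2)\<close> for large \<open>H\<close>. The bound on \<open>\<psi>\<close> is obtained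
  by Newman's method: \<open>- \<zeta>' / \<zeta> - \<zeta>\<close> is holomorphic on the closed half plane \<open>Re s \<ge> 1\<close>, so
  the series of \<open>(\<psi> n - n) / (n (n + 1))\<close> converges, which is incompatible with \<open>\<psi> n > (1 + \<epsilon>) n\<close>
  for infinitely many \<open>n\<close>. Finally \<open>1 + (2\<^sup>n - 1) = 2\<^sup>n\<close> shows that \<open>\<kappa>\<^sub>1 \<le> 1\<close>, so that the linear lower bound
  for \<open>S\<close> in terms of \<open>ln H\<close> gives the claim on the smoothness exponent.
\<close>

section \<open>Newman's Tauberian theorem\<close>

text \<open>Abel summation turns the Dirichlet series of \<open>\<Lambda>(n) - 1\<close> into the
  series of \<open>(\<psi> n - n) (n^(-s) - (n+1)^(-s))\<close>, and \<open>1 / (n (n + 1))\<close>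
  is its weight at \<open>s = 1\<close>. The two poles at \<open>s = 1\<close> cancel because
  \<open>- \<zeta>' / \<zeta>\<close> and \<open>\<zeta>\<close> both have residue 1 there.
  Elsewhere on the line \<open>Re s = 1\<close> the only danger is a zero of \<open>\<zeta>\<close>,
  excluded by the inequality \<open>3 + 4 cos x + cos (2 x) \<ge> 0\<close>. Newman's contours are
  bounded, so mere holomorphy across the line is enough: neither growth estimates for
  \<open>\<zeta>\<close> nor a zero-free region enter. The price is an a priori bound on the
  coefficients. Chebyshev's estimate \<open>\<psi> n \<le> 6 n\<close> pays it, although by itself
  its constant 6 would spoil \<open>\<kappa>\<^sub>1\<close>. Summing over integers, instead of
  integrating over a half line, keeps the truncations finite sums of entire functions.\<close>

lemma contour_integral_closed_div_id:
  fixes V :: "complex set" and R :: real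
  assumes V: "convex V" "open V" "0 \<in> V" and F: "F holomorphic_on V" and R: "R > 0"
    and p: "valid_path p" "path_image p \<subseteq> V - \<real>\<^sub>\<le>\<^sub>0" "pathstart p = -(\<i> * R)" "pathfinish p = \<i> * R"
    and q: "valid_path q" "path_image q \<subseteq> V - \<real>\<^sub>\<ge>\<^sub>0" "pathstart q = \<i> * R" "pathfinish q = -(\<i> * R)"
  shows "contour_integral p (\<lambda>z. F z / z) + contour_integral q (\<lambda>z. F z / z) = 2 * pi * \<i> * F 0"
proof -
  \<comment> \<open>Winding numbers are avoided by removing the singularity: the integrals of
    \<open>G\<close> over \<open>p\<close> and \<open>q\<close> cancel by Cauchy's theorem on a
    convex set, and there remains \<open>F 0\<close> times the integral of \<open>1 / z\<close>.
    Each half contributes \<open>\<i> * pi\<close> to the latter, with primitive \<open>Ln z\<close>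
    along \<open>p\<close> and \<open>Ln (- z)\<close> along \<open>q\<close>, whose cuts the paths
    avoid.\<close>
  define G where "G = (\<lambda>z. if z = 0 then deriv F 0 else (F z - F 0) / (z - 0))"
  have G: "G holomorphic_on V"
    unfolding G_def using pole_lemma[OF F] V by (simp add: interior_open)
  have Gpq: "(G has_contour_integral 0) (p +++ q)"
    by (rule Cauchy_theorem_convex_simple[OF G V(1)])
      (use p q in \<open>auto intro!: valid_path_join simp: path_image_join\<close>)
  have ip: "G contour_integrable_on p" and iq: "G contour_integrable_on q"
    using Gpq p q by (auto simp: contour_integrable_on_def dest: has_contour_integral_integrable)
      (meson contour_integrable_on_def contour_integrable_joinD1 contour_integrable_joinD2)+
  have sum0: "contour_integral p G + contour_integral q G = 0"
    using Gpq ip iq p q by (metis contour_integral_join contour_integral_unique)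
  have lp: "((\<lambda>z. 1 / z) has_contour_integral (Ln (\<i> * R) - Ln (-(\<i> * R)))) p"
  proof -
    have "((\<lambda>z. 1 / z) has_contour_integral (Ln (pathfinish p) - Ln (pathstart p))) p"
      by (rule contour_integral_primitive[where S = "- \<real>\<^sub>\<le>\<^sub>0"])
        (use p in \<open>auto intro!: derivative_eq_intros simp: field_simps\<close>)
    thus ?thesis using p by simp
  qed
  have lq: "((\<lambda>z. 1 / z) has_contour_integral (Ln (\<i> * R) - Ln (-(\<i> * R)))) q"
  proof -
    have "((\<lambda>z. 1 / z) has_contour_integral (Ln (- pathfinish q) - Ln (- pathstart q))) q"
      by (rule contour_integral_primitive[where S = "- \<real>\<^sub>\<ge>\<^sub>0"])
        (use q in \<open>auto intro!: derivative_eq_intros simp: complex_nonpos_Reals_iff complex_nonneg_Reals_iff field_simps\<close>)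
    thus ?thesis using q by simp
  qed
  have Lns: "Ln (\<i> * R) - Ln (-(\<i> * R)) = \<i> * pi"
    using R by (simp add: Ln_times_of_real Ln_minus Ln_times_of_real mult.commute[of \<i>]) 
  have *: "((\<lambda>z. F z / z) has_contour_integral (contour_integral r G + F 0 * (\<i> * pi))) r"
    if "G contour_integrable_on r" "((\<lambda>z. 1 / z) has_contour_integral (\<i> * pi)) r" "0 \<notin> path_image r" for r
  proof -
    have "((\<lambda>z. G z + F 0 * (1 / z)) has_contour_integral (contour_integral r G + F 0 * (\<i> * pi))) r"
      using that by (intro has_contour_integral_add has_contour_integral_lmul) (auto simp: has_contour_integral_integral)
    thus ?thesis
      by (rule has_contour_integral_eq) (use that in \<open>auto simp: G_def diff_divide_distrib\<close>)
  qed
  have "contour_integral p (\<lambda>z. F z / z) = contour_integral p G + F 0 * (\<i> * pi)"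
    by (rule contour_integral_unique[OF *[OF ip]]) (use lp p Lns in auto)
  moreover have "contour_integral q (\<lambda>z. F z / z) = contour_integral q G + F 0 * (\<i> * pi)"
    by (rule contour_integral_unique[OF *[OF iq]]) (use lq q Lns in auto)
  ultimately show ?thesis using sum0 by (simp add: algebra_simps add_eq_0_iff)
qed

text \<open>On the circle \<open>z * cnj z = R^2\<close>, so the kernel equals
  \<open>(cnj z + z) / R^2\<close>, which is real and vanishes at the two points on the imaginary
  axis.\<close>

lemma norm_newman_kernel:
  fixes z :: complex
  assumes "norm z = R" "R > 0"
  shows "norm ((1 + z^2 / R^2) / z) = 2 * \<bar>Re z\<bar> / R^2"
proof -
  have z: "z \<noteq> 0" using assms by auto
  have zz: "z * cnj z = of_real (R^2)"
    using complex_norm_square[of z] assms by simp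
  have "(1 + z^2 / R^2) / z = (cnj z + z) / of_real (R^2)"
  proof -
    have "1 + z^2 / R^2 = (z * cnj z + z * z) / of_real (R^2)"
      using assms by (simp add: zz add_divide_distrib power2_eq_square)
    also have "\<dots> / z = (cnj z + z) / of_real (R^2)"
      using z assms by (simp add: field_simps)
    finally show ?thesis .
  qed
  also have "cnj z + z = of_real (2 * Re z)"
    by (simp add: complex_eq_iff)
  finally show ?thesis using assms by (simp add: norm_divide norm_mult norm_power)
qed

text \<open>Dominated convergence: for \<open>Re z < 0\<close> the power has norm at most 1 and
  tends to 0. Working on the open parameter interval lets the end points lie on the imaginary axis,
  where the power does not decay.\<close>

lemma contour_integral_linepath_powr_tendsto_0:
  assumes k: "continuous_on (closed_segment a b) k"
    and neg: "\<And>t. 0 < t \<Longrightarrow> t < 1 \<Longrightarrow> Re (linepath a b t) < 0"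
  shows "(\<lambda>N. contour_integral (linepath a b) (\<lambda>z. of_nat (Suc N) powr z * k z)) \<longlonglongrightarrow> 0"
proof -
  define f where "f = (\<lambda>N t. of_nat (Suc N) powr linepath a b t * k (linepath a b t) * (b - a))"
  have lin: "linepath a b t \<in> closed_segment a b" if "t \<in> {0..1}" for t
    using that linepath_in_path by blast
  have cont_k: "continuous_on {0..1} (\<lambda>t. k (linepath a b t))"
    by (rule continuous_on_compose2[OF k]) (use lin in \<open>auto intro!: continuous_intros\<close>)
  have cont: "continuous_on {0..1} (f N)" for N
    unfolding f_def by (intro continuous_intros cont_k) (auto simp del: of_nat_Suc)
  obtain B where B: "\<And>t. t \<in> {0..1} \<Longrightarrow> norm (k (linepath a b t)) \<le> B"
    using compact_continuous_image[OF cont_k compact_Icc] compact_imp_bounded bounded_iff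
    by (metis (no_types, lifting) image_eqI)
  have "(\<lambda>N. integral {0<..<1} (f N)) \<longlonglongrightarrow> integral {0<..<1::real} (\<lambda>_. 0)"
  proof (rule dominated_convergence(2))
    show "f N integrable_on {0<..<1}" for N
      using integrable_continuous_real[OF cont] by (simp add: integrable_on_Icc_iff_Ioo)
    show "(\<lambda>_. B * norm (b - a)) integrable_on {0<..<1::real}"
      by (simp only: integrable_on_Icc_iff_Ioo [symmetric] integrable_const_ivl)
    show "norm (f N t) \<le> B * norm (b - a)" if "t \<in> {0<..<1}" for N t
    proof -
      have "norm (of_nat (Suc N) powr linepath a b t :: complex) = real (Suc N) powr Re (linepath a b t)"
        by (subst norm_powr_real_powr) auto
      also have "\<dots> \<le> real (Suc N) powr 0"
        using neg[of t] that by (intro powr_mono) auto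
      finally have 1: "norm (of_nat (Suc N) powr linepath a b t :: complex) \<le> 1" by simp
      have "norm (f N t) \<le> 1 * B * norm (b - a)"
        unfolding f_def norm_mult
        by (intro mult_mono 1 B) (use that B[of t] in \<open>auto intro: order_trans[OF norm_ge_zero]\<close>)
      thus ?thesis by simp
    qed
    show "(\<lambda>N. f N t) \<longlonglongrightarrow> 0" if "t \<in> {0<..<1}" for t
    proof -
      have "(\<lambda>N. norm (of_nat (Suc N) powr linepath a b t :: complex)) \<longlonglongrightarrow> 0"
      proof -
        have "(\<lambda>N. real (Suc N) powr Re (linepath a b t)) \<longlonglongrightarrow> 0"
          by (rule tendsto_neg_powr[OF neg]) 
            (use that filterlim_compose[OF filterlim_real_sequentially filterlim_Suc] in auto)
        thus ?thesis by (subst norm_powr_real_powr) auto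
      qed
      hence "(\<lambda>N. of_nat (Suc N) powr linepath a b t :: complex) \<longlonglongrightarrow> 0"
        by (rule tendsto_norm_zero_cancel)
      thus ?thesis unfolding f_def by (intro tendsto_mult_left_zero)
    qed
  qed
  moreover have "contour_integral (linepath a b) (\<lambda>z. of_nat (Suc N) powr z * k z) = integral {0<..<1} (f N)" for N
    unfolding contour_integral_integral f_def by (simp add: integral_open_interval_real mult.assoc)
  ultimately show ?thesis by simp
qed


text \<open>
  With \<open>S N\<close> the partial sums and \<open>K N z = (N + 1)\<^sup>z (1 + z\<^sup>2 / R\<^sup>2)\<close>, Cauchy's formula expresses both \<open>f 0\<close> and
  \<open>S N 0\<close> as integrals of \<open>f K N / z\<close> and \<open>S N K N / z\<close>. They share the right half of the circle of
  radius \<open>R\<close>. On the left, the entire function \<open>S N\<close> uses the other half of the circle, while \<open>f\<close>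
  uses two segments inside its domain. On the circle the factor \<open>2 \<bar>Re z\<bar> / R\<^sup>2\<close> from the kernel
  cancels the singularity of the bounds at \<open>Re z = 0\<close>, leaving an error \<open>2 C / R\<close>.
\<close>
theorem newman_tauberian:
  fixes g :: "nat \<Rightarrow> complex \<Rightarrow> complex" and C :: real
  assumes hol: "\<And>n. g n holomorphic_on UNIV" and C: "C \<ge> 0"
    and bound: "\<And>n z. Re z \<noteq> 0 \<Longrightarrow> norm z > 1 \<Longrightarrow>
      norm (g n z) \<le> C * ((real (Suc n) powr (- Re z) - real (Suc (Suc n)) powr (- Re z)) / Re z)"
    and U: "open U" "{z. Re z \<ge> 0} \<subseteq> U" "f holomorphic_on U"
    and sums: "\<And>z. Re z > 0 \<Longrightarrow> (\<lambda>n. g n z) sums f z"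
  shows "(\<lambda>n. g n 0) sums f 0"
proof -
  define S where "S = (\<lambda>N z. \<Sum>n<N. g n z)"
  have S_hol: "S N holomorphic_on UNIV" for N
    unfolding S_def by (intro holomorphic_intros hol)
  \<comment> \<open>The assumed bound telescopes, so one hypothesis controls both the partial sums
    on \<open>Re z < 0\<close> and the tails on \<open>Re z > 0\<close> by
    \<open>(N + 1)^(- Re z) / \<bar>Re z\<bar>\<close>.\<close>
  have segm: "norm (\<Sum>n=N..<M. g n z) \<le> C * ((real (Suc N) powr (- Re z) - real (Suc M) powr (- Re z)) / Re z)"
    if "Re z \<noteq> 0" "norm z > 1" "N \<le> M" for N M z
  proof -
    have "norm (\<Sum>n=N..<M. g n z) \<le> (\<Sum>n=N..<M. C * ((real (Suc n) powr (- Re z) - real (Suc (Suc n)) powr (- Re z)) / Re z))"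
      by (rule sum_norm_le) (use bound that in auto)
    also have "\<dots> = C * ((\<Sum>n=N..<M. real (Suc n) powr (- Re z) - real (Suc (Suc n)) powr (- Re z)) / Re z)"
      by (simp add: sum_distrib_left sum_divide_distrib)
    also have "(\<Sum>n=N..<M. real (Suc n) powr (- Re z) - real (Suc (Suc n)) powr (- Re z)) =
        real (Suc N) powr (- Re z) - real (Suc M) powr (- Re z)"
      using sum_Suc_diff'[of N M "\<lambda>n. - (real (Suc n) powr (- Re z))"] that by simp
    finally show ?thesis .
  qed
  have S_bound: "norm (S N z) \<le> C * (real (Suc N) powr (- Re z) / \<bar>Re z\<bar>)" if "Re z < 0" "norm z > 1" for N z
  proof -
    have "norm (S N z) \<le> C * ((1 - real (Suc N) powr (- Re z)) / Re z)"
      using segm[of z 0 N] that by (simp add: S_def atLeast0LessThan)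
    also have "\<dots> \<le> C * (real (Suc N) powr (- Re z) / \<bar>Re z\<bar>)"
      by (intro mult_left_mono C) (use that in \<open>auto simp: field_simps\<close>)
    finally show ?thesis .
  qed
  have tail: "norm (f z - S N z) \<le> C * (real (Suc N) powr (- Re z) / Re z)" if "Re z > 0" "norm z > 1" for N z
  proof (rule tendsto_upperbound)
    show "(\<lambda>M. norm (S M z - S N z)) \<longlonglongrightarrow> norm (f z - S N z)"
      using sums[OF that(1)] unfolding sums_def S_def by (intro tendsto_intros)
    show "\<forall>\<^sub>F M in sequentially. norm (S M z - S N z) \<le> C * (real (Suc N) powr (- Re z) / Re z)"
      using eventually_ge_at_top[of N]
    proof eventually_elim
      case (elim M)
      have "S M z - S N z = (\<Sum>n=N..<M. g n z)"
        unfolding S_def using elim by (metis sum_diff_nat_ivl atLeast0LessThan le0)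
      hence "norm (S M z - S N z) \<le> C * ((real (Suc N) powr (- Re z) - real (Suc M) powr (- Re z)) / Re z)"
        using segm[of z N M] that elim by simp
      also have "\<dots> \<le> C * (real (Suc N) powr (- Re z) / Re z)"
        by (intro mult_left_mono C divide_right_mono) (use that in auto)
      finally show ?case .
    qed
  qed auto
  have key: "\<exists>e. e \<longlonglongrightarrow> 0 \<and> (\<forall>N. norm (f 0 - S N 0) \<le> 2 * C / R + e N)" if R: "R > 1" for R :: real
  proof -
    define a b where "a = - (\<i> * R)" and "b = \<i> * R"
    \<comment> \<open>Compactness of a segment of the imaginary axis gives a uniform margin to its
      left. The height \<open>R + 1\<close> exceeds \<open>R\<close> so that the end points of the
      contour lie in the open convex set \<open>V\<close>.\<close>
    obtain \<delta> where \<delta>: "\<delta> > 0" "{z. Re z > -\<delta> \<and> \<bar>Im z\<bar> < R + 1} \<subseteq> U"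
    proof -
      define T where "T = closed_segment (- (\<i> * (R + 1))) (\<i> * (R + 1))"
      have inT: "\<i> * y \<in> T" if "\<bar>y\<bar> \<le> R + 1" for y :: real
        unfolding T_def using that R
        by (auto simp: closed_segment_same_Re closed_segment_eq_real_ivl)
      have "compact T" by (simp add: T_def)
      have "T \<subseteq> U"
        using U(2) by (auto simp: T_def closed_segment_same_Re)
      then obtain \<delta> where \<delta>: "\<delta> > 0" "(\<Union>x\<in>T. ball x \<delta>) \<subseteq> U"
        using compact_subset_open_imp_ball_epsilon_subset[of T U] U(1) \<open>compact T\<close> \<open>T \<subseteq> U\<close> by metis
      have "z \<in> U" if "Re z > -\<delta>" "\<bar>Im z\<bar> < R + 1" for z
      proof (cases "Re z \<ge> 0")
        case False
        have "\<i> * Im z \<in> T" by (rule inT) (use that in auto)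
        moreover have "norm (\<i> * Im z - z) = \<bar>Re z\<bar>"
          by (simp add: cmod_def)
        ultimately show ?thesis using \<delta>(2) that False by (force simp: dist_norm)
      qed (use U in auto)
      thus ?thesis using that \<delta>(1) by blast
    qed
    define V where "V = {z. Re z > -\<delta> \<and> \<bar>Im z\<bar> < R + 1}"
    have V_eq: "V = {z. Re z > -\<delta>} \<inter> {z. Im z < R + 1} \<inter> {z. Im z > -(R+1)}"
      by (auto simp: V_def)
    have V: "convex V" "open V" "0 \<in> V" "f holomorphic_on V"
      using \<delta> R U(3) by (auto simp: V_eq V_def intro!: convex_Int open_Int convex_halfspace_Re_gt convex_halfspace_Im_gt
          convex_halfspace_Im_lt open_halfspace_Re_gt open_halfspace_Im_gt open_halfspace_Im_lt holomorphic_on_subset[OF U(3)])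
    define K where "K = (\<lambda>N (z::complex). of_nat (Suc N) powr z * (1 + z\<^sup>2 / R\<^sup>2) :: complex)"
    have K_hol: "K N holomorphic_on A" for N A
      unfolding K_def using R by (intro holomorphic_intros) (auto simp del: of_nat_Suc)
    have K0: "K N 0 = 1" for N by (simp add: K_def del: of_nat_Suc)
    have K_norm: "norm (K N z / z) = real (Suc N) powr Re z * (2 * \<bar>Re z\<bar> / R\<^sup>2)" if "norm z = R" for N z
    proof -
      have "K N z / z = of_nat (Suc N) powr z * ((1 + z\<^sup>2 / R\<^sup>2) / z)" by (simp add: K_def)
      hence "norm (K N z / z) = norm (of_nat (Suc N) powr z :: complex) * norm ((1 + z\<^sup>2 / R\<^sup>2) / z)"
        by (simp only: norm_mult)
      also have "norm (of_nat (Suc N) powr z :: complex) = real (Suc N) powr Re z"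
        by (subst norm_powr_real_powr) auto
      finally show ?thesis using norm_newman_kernel[OF that] R by simp
    qed
    define p q1 q2 r where "p = part_circlepath 0 R (-pi/2) (pi/2)" and "q1 = linepath b (-\<delta>/2)"
      and "q2 = linepath (-\<delta>/2) a" and "r = part_circlepath 0 R (pi/2) (3*pi/2)"
    have exps: "exp (\<i> * complex_of_real (-pi/2)) = -\<i>" "exp (\<i> * complex_of_real (pi/2)) = \<i>"
        "exp (\<i> * complex_of_real (3*pi/2)) = -\<i>"
      using sin_3over2_pi cos_3over2_pi by (auto simp: complex_eq_iff Re_exp Im_exp simp del: of_real_divide of_real_mult)
    have p: "valid_path p" "pathstart p = a" "pathfinish p = b"
      and r: "valid_path r" "pathstart r = b" "pathfinish r = a"
      using exps by (simp_all add: p_def r_def a_def b_def)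
    have p_im: "norm z = R \<and> Re z \<ge> 0" if "z \<in> path_image p" for z
      using that R by (auto simp: p_def path_image_part_circlepath norm_mult Re_exp cos_ge_zero)
    have r_im: "norm z = R \<and> Re z \<le> 0" if "z \<in> path_image r" for z
    proof -
      have "cos t \<le> 0" if "pi / 2 \<le> t" "t \<le> 3 * pi / 2" for t
        using cos_ge_zero[of "t - pi"] that by (simp add: cos_diff)
      thus ?thesis using that R
        by (auto simp: r_def path_image_part_circlepath norm_mult Re_exp mult_nonneg_nonpos)
    qed
    have nonzero_end: "z = a \<or> z = b" if "norm z = R" "Re z = 0" for z
      using that R by (auto simp: a_def b_def cmod_def complex_eq_iff)
    have p_cut: "path_image p \<subseteq> V - \<real>\<^sub>\<le>\<^sub>0"
    proof
      fix z assume z: "z \<in> path_image p"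
      from p_im[OF z] have "\<bar>Im z\<bar> \<le> R" using abs_Im_le_cmod[of z] by simp
      thus "z \<in> V - \<real>\<^sub>\<le>\<^sub>0"
        using p_im[OF z] R \<delta> by (auto simp: V_def complex_nonpos_Reals_iff cmod_def)
    qed
    have r_cut: "path_image r \<subseteq> UNIV - \<real>\<^sub>\<ge>\<^sub>0"
      using r_im R by (force simp: complex_nonneg_Reals_iff cmod_def)
    have ab: "a \<in> V" "b \<in> V" "complex_of_real (-\<delta>/2) \<in> V"
      using R \<delta> by (auto simp: V_def a_def b_def)
    have q_neg: "Re (linepath b (-\<delta>/2) t) < 0" "Re (linepath (-\<delta>/2) a (1-t)) < 0" if "t > 0" for t :: real
      using that \<delta> by (auto simp: linepath_def a_def b_def)
    have q_cut1: "path_image q1 \<subseteq> V - \<real>\<^sub>\<ge>\<^sub>0"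
    proof
      fix z assume z: "z \<in> path_image q1"
      then obtain t where t: "z = linepath b (-\<delta>/2) t" "0 \<le> t" "t \<le> 1"
        by (auto simp: q1_def path_image_def)
      have "z \<notin> \<real>\<^sub>\<ge>\<^sub>0"
        using q_neg(1)[of t] t R by (cases "t = 0") (auto simp: complex_nonneg_Reals_iff b_def linepath_0')
      moreover have "z \<in> V" using closed_segment_subset[OF ab(2,3) V(1)] z by (auto simp: q1_def)
      ultimately show "z \<in> V - \<real>\<^sub>\<ge>\<^sub>0" by simp
    qed
    have q_cut2: "path_image q2 \<subseteq> V - \<real>\<^sub>\<ge>\<^sub>0"
    proof
      fix z assume z: "z \<in> path_image q2"
      then obtain t where t: "z = linepath (-\<delta>/2) a t" "0 \<le> t" "t \<le> 1"
        by (auto simp: q2_def path_image_def)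
      have "z \<notin> \<real>\<^sub>\<ge>\<^sub>0"
        using q_neg(2)[of "1 - t"] t R by (cases "t = 1") (auto simp: complex_nonneg_Reals_iff a_def linepath_1')
      moreover have "z \<in> V" using closed_segment_subset[OF ab(3,1) V(1)] z by (auto simp: q2_def)
      ultimately show "z \<in> V - \<real>\<^sub>\<ge>\<^sub>0" by simp
    qed
    have q: "valid_path (q1 +++ q2)" "path_image (q1 +++ q2) \<subseteq> V - \<real>\<^sub>\<ge>\<^sub>0"
        "pathstart (q1 +++ q2) = b" "pathfinish (q1 +++ q2) = a"
      using q_cut1 q_cut2 by (auto simp: q1_def q2_def path_image_join)
    have no0: "0 \<notin> path_image p" "0 \<notin> path_image r" "0 \<notin> path_image q1" "0 \<notin> path_image q2"
      using p_cut r_cut q_cut1 q_cut2 by auto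
    have f_cont: "continuous_on A f" if "A \<subseteq> V" for A
      using V(4) that holomorphic_on_imp_continuous_on continuous_on_subset by blast
    have S_cont: "continuous_on A (S N)" for A N
      using S_hol holomorphic_on_imp_continuous_on continuous_on_subset by blast
    have K_cont: "continuous_on A (K N)" for A N
      using K_hol holomorphic_on_imp_continuous_on by blast
    have int_p: "(\<lambda>z. f z * K N z / z) contour_integrable_on p" "(\<lambda>z. S N z * K N z / z) contour_integrable_on p" for N
      unfolding p_def by (intro contour_integrable_continuous_part_circlepath continuous_intros f_cont S_cont K_cont;
          use p_cut no0 in \<open>auto simp: p_def\<close>)+
    have int_r: "(\<lambda>z. S N z * K N z / z) contour_integrable_on r" for N
      unfolding r_def by (intro contour_integrable_continuous_part_circlepath continuous_intros S_cont K_cont;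
          use no0 in \<open>auto simp: r_def\<close>)
    have int_q: "(\<lambda>z. f z * K N z / z) contour_integrable_on q1" "(\<lambda>z. f z * K N z / z) contour_integrable_on q2" for N
      unfolding q1_def q2_def by (intro contour_integrable_continuous_linepath continuous_intros f_cont K_cont;
          use q_cut1 q_cut2 no0 in \<open>auto simp: q1_def q2_def\<close>)+
    define e where "e = (\<lambda>N. contour_integral q1 (\<lambda>z. f z * K N z / z) + contour_integral q2 (\<lambda>z. f z * K N z / z))"
    have cauchy_f: "contour_integral p (\<lambda>z. f z * K N z / z) + e N = 2 * pi * \<i> * f 0" for N
    proof -
      have "contour_integral p (\<lambda>z. f z * K N z / z) + contour_integral (q1 +++ q2) (\<lambda>z. f z * K N z / z) =
          2 * pi * \<i> * (f 0 * K N 0)"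
        by (rule contour_integral_closed_div_id[where F = "\<lambda>z. f z * K N z", OF V(1-3) _ _ p(1) p_cut _ _ q(1,2)])
          (use p q R in \<open>auto simp: a_def b_def intro!: holomorphic_intros V(4) K_hol\<close>)
      thus ?thesis using int_q by (simp add: e_def K0 q1_def q2_def)
    qed
    have cauchy_S: "contour_integral p (\<lambda>z. S N z * K N z / z) + contour_integral r (\<lambda>z. S N z * K N z / z) =
        2 * pi * \<i> * S N 0" for N
    proof -
      have "contour_integral p (\<lambda>z. S N z * K N z / z) + contour_integral r (\<lambda>z. S N z * K N z / z) =
          2 * pi * \<i> * (S N 0 * K N 0)"
        by (rule contour_integral_closed_div_id[where F = "\<lambda>z. S N z * K N z" and V = UNIV, OF _ _ _ _ _ p(1) _ _ _ r(1) r_cut])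
          (use p p_cut r R in \<open>auto simp: a_def b_def intro!: holomorphic_intros S_hol K_hol\<close>)
      thus ?thesis by (simp add: K0)
    qed
    \<comment> \<open>At \<open>a\<close> and \<open>b\<close> the tail bound would divide by
      \<open>Re z = 0\<close>; the estimate for arcs tolerates such a finite exceptional
      set.\<close>
    have bound_p: "norm (contour_integral p (\<lambda>z. f z * K N z / z) - contour_integral p (\<lambda>z. S N z * K N z / z)) \<le>
        2 * C / R\<^sup>2 * R * (pi/2 - (-pi/2))" for N
    proof -
      have "norm (contour_integral p (\<lambda>z. f z * K N z / z - S N z * K N z / z)) \<le> 2 * C / R\<^sup>2 * R * (pi/2 - (-pi/2))"
        unfolding p_def
      proof (rule contour_integral_bound_part_circlepath_strong[where k = "{a, b}"])
        fix z assume z: "z \<in> path_image (part_circlepath 0 R (-pi/2) (pi/2)) - {a, b}"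
        hence z': "norm z = R" "Re z > 0"
          using p_im[of z] nonzero_end[of z] by (force simp: p_def)+
        have "norm (f z * K N z / z - S N z * K N z / z) = norm (f z - S N z) * norm (K N z / z)"
          by (simp add: norm_mult [symmetric] algebra_simps diff_divide_distrib)
        also have "\<dots> \<le> C * (real (Suc N) powr (- Re z) / Re z) * (real (Suc N) powr Re z * (2 * \<bar>Re z\<bar> / R\<^sup>2))"
          unfolding K_norm[OF z'(1)] by (intro mult_right_mono tail) (use z' R in auto)
        also have "\<dots> = C * (2 / R\<^sup>2) * (real (Suc N) powr (- Re z) * real (Suc N) powr Re z)"
          using z' by simp
        also have "\<dots> = 2 * C / R\<^sup>2"
          by (subst powr_add [symmetric]) (simp del: of_nat_Suc)
        finally show "norm (f z * K N z / z - S N z * K N z / z) \<le> 2 * C / R\<^sup>2" .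
      qed (use int_p R C in \<open>auto simp: p_def intro!: contour_integrable_diff\<close>)
      thus ?thesis by (simp add: contour_integral_diff int_p)
    qed
    have bound_r: "norm (contour_integral r (\<lambda>z. S N z * K N z / z)) \<le> 2 * C / R\<^sup>2 * R * (3*pi/2 - pi/2)" for N
      unfolding r_def
    proof (rule contour_integral_bound_part_circlepath_strong[where k = "{a, b}"])
      fix z assume z: "z \<in> path_image (part_circlepath 0 R (pi/2) (3*pi/2)) - {a, b}"
      hence z': "norm z = R" "Re z < 0"
        using r_im[of z] nonzero_end[of z] by (force simp: r_def)+
      have "norm (S N z * K N z / z) = norm (S N z) * norm (K N z / z)"
        by (simp add: norm_mult norm_divide)
      also have "\<dots> \<le> C * (real (Suc N) powr (- Re z) / \<bar>Re z\<bar>) * (real (Suc N) powr Re z * (2 * \<bar>Re z\<bar> / R\<^sup>2))"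
        unfolding K_norm[OF z'(1)] using z' R
        by (intro mult_right_mono S_bound mult_nonneg_nonneg divide_nonneg_nonneg) simp_all
      also have "\<dots> = C * (2 / R\<^sup>2) * (real (Suc N) powr (- Re z) * real (Suc N) powr Re z)"
        using z' by simp
      also have "\<dots> = 2 * C / R\<^sup>2"
        by (subst powr_add [symmetric]) (simp del: of_nat_Suc)
      finally show "norm (S N z * K N z / z) \<le> 2 * C / R\<^sup>2" .
    qed (use int_r R C in \<open>auto simp: r_def\<close>)
    have e_lim: "e \<longlonglongrightarrow> 0"
    proof -
      have cont: "continuous_on A (\<lambda>z. f z * (1 + z\<^sup>2 / R\<^sup>2) / z)" if "A \<subseteq> V" "0 \<notin> A" for A
        using that R by (intro continuous_intros f_cont) auto
      have e_eq: "e = (\<lambda>N. contour_integral q1 (\<lambda>z. of_nat (Suc N) powr z * (f z * (1 + z\<^sup>2 / R\<^sup>2) / z)) +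
          contour_integral q2 (\<lambda>z. of_nat (Suc N) powr z * (f z * (1 + z\<^sup>2 / R\<^sup>2) / z)))"
        unfolding e_def K_def by (simp add: mult_ac)
      have "e \<longlonglongrightarrow> 0 + 0"
        unfolding e_eq unfolding q1_def q2_def
      proof (intro tendsto_add contour_integral_linepath_powr_tendsto_0 cont)
        show "closed_segment b (complex_of_real (- \<delta> / 2)) \<subseteq> V" "closed_segment (complex_of_real (- \<delta> / 2)) a \<subseteq> V"
          "0 \<notin> closed_segment b (complex_of_real (- \<delta> / 2))" "0 \<notin> closed_segment (complex_of_real (- \<delta> / 2)) a"
          using q_cut1 q_cut2 no0 by (auto simp: q1_def q2_def)
        show "Re (linepath b (complex_of_real (- \<delta> / 2)) t) < 0" if "0 < t" for t
          using q_neg(1)[of t] that by simp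
        show "Re (linepath (complex_of_real (- \<delta> / 2)) a t) < 0" if "t < 1" for t
          using q_neg(2)[of "1 - t"] that by simp
      qed
      thus ?thesis by simp
    qed
    have tri: "norm (x - y + z) \<le> A + B + norm z" if "norm x \<le> A" "norm y \<le> B" for x y z :: complex and A B
      using that norm_triangle_ineq[of "x - y" z] norm_triangle_ineq4[of x y] by linarith
    have "norm (f 0 - S N 0) \<le> 2 * C / R + norm (e N) / (2 * pi)" for N
    proof -
      have "2 * pi * \<i> * (f 0 - S N 0) = 
          (contour_integral p (\<lambda>z. f z * K N z / z) - contour_integral p (\<lambda>z. S N z * K N z / z))
          - contour_integral r (\<lambda>z. S N z * K N z / z) + e N"
        using cauchy_f[of N] cauchy_S[of N] by (simp add: algebra_simps)
      hence "norm (2 * pi * \<i> * (f 0 - S N 0)) \<le> 2 * C / R\<^sup>2 * R * (pi/2 - (-pi/2)) + 2 * C / R\<^sup>2 * R * (3*pi/2 - pi/2) + norm (e N)"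
        using bound_p[of N] bound_r[of N] by (simp only:) (rule tri)
      also have "\<dots> = 2 * pi * (2 * C / R + norm (e N) / (2 * pi))"
        using R by (simp add: field_simps power2_eq_square)
      also have "norm (2 * pi * \<i> * (f 0 - S N 0)) = 2 * pi * norm (f 0 - S N 0)"
        by (simp add: norm_mult)
      finally show ?thesis using pi_gt_zero by (simp del: times_divide_eq_right add: mult_le_cancel_left)
    qed
    moreover have "(\<lambda>N. norm (e N) / (2 * pi)) \<longlonglongrightarrow> 0"
      using tendsto_divide_zero[OF tendsto_norm_zero[OF e_lim]] .
    ultimately show ?thesis by (intro exI[of _ "\<lambda>N. norm (e N) / (2 * pi)"]) blast
  qed
  have "(\<lambda>N. S N 0) \<longlonglongrightarrow> f 0"
  proof (rule LIMSEQ_I)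
    fix \<epsilon> :: real assume \<epsilon>: "\<epsilon> > 0"
    \<comment> \<open>Each half circle contributes at most \<open>2 * pi * C / R\<close>, hence an
      error \<open>2 * C / R\<close> after division by \<open>2 * pi\<close>. The first summand
      makes it at most \<open>\<epsilon> / 2\<close>, and the second gives \<open>R > 1\<close>,
      where \<open>bound\<close> applies.\<close>
    define R where "R = 4 * C / \<epsilon> + 2"
    have "4 * C / \<epsilon> \<ge> 0" using C \<epsilon> by simp
    hence R: "R > 1" by (simp add: R_def)
    have "2 * C / R \<le> \<epsilon> / 2"
      using C \<epsilon> R by (simp add: R_def field_simps)
    obtain e where e: "e \<longlonglongrightarrow> 0" "\<And>N. norm (f 0 - S N 0) \<le> 2 * C / R + e N"
      using key[OF R] by blast
    from e(1) \<epsilon> obtain N0 where "\<And>N. N \<ge> N0 \<Longrightarrow> \<bar>e N\<bar> < \<epsilon> / 2"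
      using LIMSEQ_D[of e 0 "\<epsilon> / 2"] by auto
    hence "norm (S N 0 - f 0) < \<epsilon>" if "N \<ge> N0" for N
      using e(2)[of N] that \<open>2 * C / R \<le> \<epsilon> / 2\<close> by (smt (verit) field_sum_of_halves norm_minus_commute)
    thus "\<exists>no. \<forall>n\<ge>no. norm (S n 0 - f 0) < \<epsilon>" by blast
  qed
  thus ?thesis unfolding sums_def S_def .
qed

section \<open>The zeta function on the half plane \<open>Re s \<ge> 1\<close>\<close>

lemma norm_of_nat_powr: "norm (of_nat n powr s :: complex) = real n powr Re s"
  by (subst norm_powr_real_powr) auto

lemma norm_diff_le_derivative_bound:
  fixes f :: "real \<Rightarrow> 'a :: real_normed_vector"
  assumes "a < b" "\<And>t. t \<in> {a..b} \<Longrightarrow> (f has_vector_derivative f' t) (at t)"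
    "\<And>t. t \<in> {a..b} \<Longrightarrow> norm (f' t) \<le> B"
  shows "norm (f b - f a) \<le> B * (b - a)"
proof -
  have "norm (f b - f a) \<le> B * b - B * a"
  proof (rule differentiable_bound_general[where f' = f' and \<phi>' = "\<lambda>_. B"])
    show "continuous_on {a..b} f"
      using assms(2) by (meson continuous_at_imp_continuous_on has_vector_derivative_continuous)
    show "((*) B has_vector_derivative B) (at x)" for x
      by (auto intro!: derivative_eq_intros)
  qed (use assms in \<open>auto intro!: continuous_intros\<close>)
  thus ?thesis by (simp add: algebra_simps)
qed

lemma has_vector_derivative_of_real_powr:
  assumes "t > 0"
  shows "((\<lambda>t. complex_of_real t powr s) has_vector_derivative s * complex_of_real t powr (s - 1)) (at t)"
  by (rule has_vector_derivative_real_field, rule has_field_derivative_powr) (use assms in auto)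

text \<open>The derivative has norm \<open>\<bar>s\<bar> t^(- Re s - 1)\<close>, which for
  \<open>Re s \<ge> - 1\<close> is largest at the left end point.\<close>

lemma norm_of_real_powr_diff_le:
  fixes s :: complex
  assumes "0 < a" "a \<le> x" "Re s \<ge> - 1"
  shows "norm (of_real x powr - s - of_real a powr - s :: complex) \<le> norm s * a powr (- Re s - 1) * (x - a)"
proof (cases "a < x")
  case True
  show ?thesis
  proof (rule norm_diff_le_derivative_bound[OF True])
    fix t assume t: "t \<in> {a..x}"
    thus "((\<lambda>t. complex_of_real t powr - s) has_vector_derivative - s * complex_of_real t powr (- s - 1)) (at t)"
      using assms by (intro has_vector_derivative_of_real_powr) auto
    show "norm (- s * complex_of_real t powr (- s - 1)) \<le> norm s * a powr (- Re s - 1)"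
      using t assms by (auto simp: norm_mult norm_powr_real_powr intro!: mult_left_mono powr_mono2')
  qed
qed (use assms in auto)

lemma summable_powr_Suc: "\<sigma> > 1 \<Longrightarrow> summable (\<lambda>n. real (Suc n) powr - \<sigma>)"
  unfolding summable_Suc_iff[of "\<lambda>n. real n powr - \<sigma>"] by (simp add: summable_real_powr_iff)

lemma summable_ln_powr_Suc:
  assumes "\<sigma> > 1"
  shows "summable (\<lambda>n. ln (real (Suc n)) * real (Suc n) powr - \<sigma>)"
proof (rule summable_comparison_test')
  \<comment> \<open>Half of the excess of \<open>\<sigma>\<close> over 1 absorbs the logarithm, and
    the other half keeps the exponent summable.\<close>
  define a where "a = (\<sigma> - 1) / 2"
  have a: "a > 0" "\<sigma> - a > 1" using assms by (auto simp: a_def field_simps)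
  show "summable (\<lambda>n. real (Suc n) powr - (\<sigma> - a) / a)"
    using summable_powr_Suc[OF a(2)] by (rule summable_divide)
  fix n
  have "ln (real (Suc n)) * real (Suc n) powr - \<sigma> \<le> real (Suc n) powr a / a * real (Suc n) powr - \<sigma>"
    by (intro mult_right_mono ln_powr_bound a) auto
  also have "\<dots> = real (Suc n) powr - (\<sigma> - a) / a"
    by (simp add: powr_add [symmetric] algebra_simps del: of_nat_Suc)
  finally show "norm (ln (real (Suc n)) * real (Suc n) powr - \<sigma>) \<le> real (Suc n) powr - (\<sigma> - a) / a"
    by (subst real_norm_def, subst abs_of_nonneg) auto
qed

section \<open>Dirichlet series in the half plane of absolute convergence\<close>

definition zeta_series :: "complex \<Rightarrow> complex" where
  "zeta_series s = (\<Sum>n. of_nat (Suc n) powr - s)"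

definition mangoldt_series :: "complex \<Rightarrow> complex" where
  "mangoldt_series s = (\<Sum>n. mangoldt (Suc n) * of_nat (Suc n) powr - s)"

lemma summable_norm_zeta_series:
  "Re s > 1 \<Longrightarrow> summable (\<lambda>n. norm (of_nat (Suc n) powr - s :: complex))"
  using summable_powr_Suc[of "Re s"] by (simp only: norm_of_nat_powr uminus_complex.sel)

lemma norm_mangoldt_term_le:
  assumes "Re s \<ge> \<sigma>"
  shows "norm (mangoldt (Suc n) * of_nat (Suc n) powr - s :: complex) \<le> ln (real (Suc n)) * real (Suc n) powr - \<sigma>"
  unfolding norm_mult norm_of_nat_powr norm_mangoldt
  by (intro mult_mono mangoldt_le mangoldt_nonneg powr_mono) (use assms in auto)

lemma summable_norm_mangoldt_series:
  assumes "Re s > 1"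
  shows "summable (\<lambda>n. norm (mangoldt (Suc n) * of_nat (Suc n) powr - s :: complex))"
  by (rule summable_comparison_test'[OF summable_ln_powr_Suc[OF assms]])
    (use norm_mangoldt_term_le[of "Re s" s] in auto)

lemma zeta_series_sums: "Re s > 1 \<Longrightarrow> (\<lambda>n. of_nat (Suc n) powr - s) sums zeta_series s"
  unfolding zeta_series_def by (rule summable_sums[OF summable_norm_cancel[OF summable_norm_zeta_series]])

lemma mangoldt_series_sums:
  "Re s > 1 \<Longrightarrow> (\<lambda>n. mangoldt (Suc n) * of_nat (Suc n) powr - s) sums mangoldt_series s"
  unfolding mangoldt_series_def by (rule summable_sums[OF summable_norm_cancel[OF summable_norm_mangoldt_series]])

text \<open>Local domination justifies differentiating term by term. The derivative is kept as an
  explicit series so that it can be matched with a Dirichlet product.\<close>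

lemma zeta_series_has_derivative:
  fixes s :: complex
  assumes "Re s > 1"
  shows "\<exists>D. (zeta_series has_field_derivative D) (at s) \<and>
    (\<lambda>n. - (ln (real (Suc n)) * of_nat (Suc n) powr - s)) sums D"
proof -
  define S where "S = {s. Re s > 1}"
  have S: "open S" unfolding S_def by (rule open_halfspace_Re_gt)
  have "\<exists>g g'. \<forall>x\<in>S. (\<lambda>n. of_nat (Suc n) powr - x) sums g x \<and>
      (\<lambda>n. - (ln (real (Suc n)) * of_nat (Suc n) powr - x)) sums g' x \<and> (g has_field_derivative g' x) (at x)"
  proof (rule series_and_derivative_comparison_local[OF S])
    fix n :: nat and x :: complex
    show "((\<lambda>x. of_nat (Suc n) powr - x) has_field_derivative - (ln (real (Suc n)) * of_nat (Suc n) powr - x)) (at x)"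
    proof -
      have "((\<lambda>x. of_nat (Suc n) powr - x) has_field_derivative (Ln (of_nat (Suc n)) * of_nat (Suc n) powr - x) * - 1) (at x)"
        by (rule DERIV_chain2[OF has_field_derivative_powr_right])
          (simp_all add: DERIV_minus[OF DERIV_ident] del: of_nat_Suc)
      thus ?thesis by (simp add: Ln_of_nat del: of_nat_Suc)
    qed
  next
    fix x assume x: "x \<in> S"
    define d where "d = (Re x - 1) / 2"
    have d: "d > 0" using x by (simp add: d_def S_def)
    have "norm (of_nat (Suc n) powr - y :: complex) \<le> real (Suc n) powr - (1 + d)" if "y \<in> ball x d" for n y
    proof -
      have "\<bar>Re (x - y)\<bar> < d" using that abs_Re_le_cmod[of "x - y"] by (simp add: dist_norm)
      moreover have "2 * d = Re x - 1" by (simp add: d_def)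
      ultimately have "Re y \<ge> 1 + d" by auto
      thus ?thesis unfolding norm_of_nat_powr by (intro powr_mono) auto
    qed
    hence "\<forall>\<^sub>F n in sequentially. \<forall>y\<in>ball x d \<inter> S. norm (of_nat (Suc n) powr - y :: complex) \<le> real (Suc n) powr - (1 + d)"
      by (intro always_eventually) blast
    moreover have "summable (\<lambda>n. real (Suc n) powr - (1 + d))"
      by (rule summable_powr_Suc) (use d in auto)
    ultimately show "\<exists>d h. 0 < d \<and> summable h \<and> (\<forall>\<^sub>F n in sequentially. \<forall>y\<in>ball x d \<inter> S. norm (of_nat (Suc n) powr - y :: complex) \<le> h n)"
      using d by (intro exI[of _ d] exI[of _ "\<lambda>n. real (Suc n) powr - (1 + d)"] conjI)
  qed
  then obtain g g' where "\<forall>x\<in>S. (\<lambda>n. of_nat (Suc n) powr - x) sums g x \<and>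
      (\<lambda>n. - (ln (real (Suc n)) * of_nat (Suc n) powr - x)) sums g' x \<and> (g has_field_derivative g' x) (at x)"
    by (elim exE)
  hence g: "\<And>x. x \<in> S \<Longrightarrow> (\<lambda>n. of_nat (Suc n) powr - x) sums g x"
      "\<And>x :: complex. x \<in> S \<Longrightarrow> (\<lambda>n. - (ln (real (Suc n)) * of_nat (Suc n) powr - x)) sums g' x"
      "\<And>x. x \<in> S \<Longrightarrow> (g has_field_derivative g' x) (at x)" by simp_all
  have s: "s \<in> S" using assms by (simp add: S_def)
  have "(zeta_series has_field_derivative g' s) (at s)"
    by (rule has_field_derivative_transform_within_open[OF g(3)[OF s] S s])
      (simp only: zeta_series_def sums_unique[OF g(1)])
  thus ?thesis using g(2)[OF s] by blast
qed

text \<open>This is the convolution identity \<open>\<Lambda> * 1 = ln\<close>: absolute convergence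
  allows the double series to be regrouped by the value of the product, and \<open>\<Lambda>\<close>
  sums to \<open>ln k\<close> over the divisors of \<open>k\<close>.\<close>

lemma mangoldt_series_times_zeta_series:
  fixes s :: complex
  assumes s: "Re s > 1"
  shows "(\<lambda>n. ln (real (Suc n)) * of_nat (Suc n) powr - s) sums (mangoldt_series s * zeta_series s)"
proof -
  define f g where "f = (\<lambda>n. mangoldt (Suc n) * of_nat (Suc n) powr - s :: complex)"
    and "g = (\<lambda>n. of_nat (Suc n) powr - s :: complex)"
  have f: "(f has_sum mangoldt_series s) UNIV"
    unfolding f_def by (rule norm_summable_imp_has_sum[OF summable_norm_mangoldt_series[OF s] mangoldt_series_sums[OF s]])
  have g: "(g has_sum zeta_series s) UNIV"
    unfolding g_def by (rule norm_summable_imp_has_sum[OF summable_norm_zeta_series[OF s] zeta_series_sums[OF s]])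
  have fa: "(\<lambda>n. norm (f n)) summable_on UNIV" and ga: "(\<lambda>n. norm (g n)) summable_on UNIV"
    using summable_norm_mangoldt_series[OF s] summable_norm_zeta_series[OF s]
    by (simp_all add: f_def g_def summable_on_UNIV_nonneg_real_iff)
  have "(\<lambda>x. norm (case x of (m, n) \<Rightarrow> f m * g n)) summable_on (UNIV \<times> UNIV)"
    unfolding Infinite_Sum.abs_summable_on_Sigma_iff using fa ga
    by (auto simp: norm_mult infsum_cmult_right' infsum_nonneg abs_mult intro!: summable_on_cmult_right summable_on_cmult_left)
  hence summ: "(\<lambda>(m, n). f m * g n) summable_on (UNIV \<times> UNIV)"
    by (rule abs_summable_summable)
  have prod: "((\<lambda>(m, n). f m * g n) has_sum (mangoldt_series s * zeta_series s)) (UNIV \<times> UNIV)"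
    by (rule has_sum_SigmaI[OF _ _ summ, where g = "\<lambda>m. f m * zeta_series s"])
      (use f g in \<open>auto intro!: has_sum_cmult_right has_sum_cmult_left\<close>)
  have "((\<lambda>(m, n). f m * g n) has_sum (mangoldt_series s * zeta_series s)) (UNIV \<times> UNIV) \<longleftrightarrow>
      ((\<lambda>(k, d). mangoldt d * of_nat (Suc k) powr - s) has_sum (mangoldt_series s * zeta_series s)) (Sigma UNIV (\<lambda>k. {d. d dvd Suc k}))"
  \<comment> \<open>The pair \<open>(m, n)\<close> stands for the factors \<open>m + 1\<close> and
    \<open>n + 1\<close>; it goes to the shifted product together with the first factor, a divisor
    of \<open>Suc k\<close>.\<close>
  proof (rule has_sum_reindex_bij_witness[where j = "\<lambda>(m, n). (Suc m * Suc n - 1, Suc m)" and i = "\<lambda>(k, d). (d - 1, Suc k div d - 1)"])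
    fix a :: "nat \<times> nat"
    obtain m n where a: "a = (m, n)" by force
    have "of_nat (Suc m * Suc n) powr - s = of_nat (Suc m) powr - s * (of_nat (Suc n) powr - s :: complex)"
      unfolding of_nat_mult by (subst powr_times_real) (auto simp del: of_nat_Suc)
    thus "(case case a of (m, n) \<Rightarrow> (Suc m * Suc n - 1, Suc m) of (k, d) \<Rightarrow> mangoldt d * of_nat (Suc k) powr - s) =
        (case a of (m, n) \<Rightarrow> f m * g n)"
      by (simp add: a f_def g_def del: of_nat_Suc mult_Suc mult_Suc_right)
  next
    fix b :: "nat \<times> nat" assume b: "b \<in> Sigma UNIV (\<lambda>k. {d. d dvd Suc k})"
    then obtain k d where kd: "b = (k, d)" "d dvd Suc k" by auto
    then obtain e where e: "Suc k = d * e" by (auto elim: dvdE)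
    hence "d > 0" "e > 0" by (auto intro!: Nat.gr0I)
    thus "(case case b of (k, d) \<Rightarrow> (d - 1, Suc k div d - 1) of (m, n) \<Rightarrow> (Suc m * Suc n - 1, Suc m)) = b"
      using kd e by (simp del: mult_Suc mult_Suc_right)
  qed (auto simp del: mult_Suc mult_Suc_right simp: dvd_def)
  with prod have "((\<lambda>(k, d). mangoldt d * of_nat (Suc k) powr - s) has_sum (mangoldt_series s * zeta_series s)) (Sigma UNIV (\<lambda>k. {d. d dvd Suc k}))"
    by blast
  hence "((\<lambda>k. \<Sum>d | d dvd Suc k. mangoldt d * of_nat (Suc k) powr - s) has_sum (mangoldt_series s * zeta_series s)) UNIV"
    by (rule has_sum_SigmaD) (auto intro!: has_sum_finiteI)
  hence "((\<lambda>k. ln (real (Suc k)) * of_nat (Suc k) powr - s) has_sum (mangoldt_series s * zeta_series s)) UNIV"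
    by (simp add: sum_distrib_right [symmetric] mangoldt_sum del: of_nat_Suc)
  thus ?thesis by (rule has_sum_imp_sums)
qed

lemma zeta_series_derivative:
  assumes "Re s > 1"
  shows "(zeta_series has_field_derivative - (mangoldt_series s * zeta_series s)) (at s)"
proof -
  obtain D where D: "(zeta_series has_field_derivative D) (at s)"
      "(\<lambda>n. - (ln (real (Suc n)) * of_nat (Suc n) powr - s)) sums D"
    using zeta_series_has_derivative[OF assms] by blast
  have "D = - (mangoldt_series s * zeta_series s)"
    using sums_unique2[OF D(2) sums_minus[OF mangoldt_series_times_zeta_series[OF assms]]] by simp
  thus ?thesis using D(1) by simp
qed

text \<open>
  This is \<open>(s - 1) \<zeta>(s)\<close>: for \<open>Re s > 1\<close> the powers with exponent \<open>1 - s\<close> telescope to \<open>- 1\<close>. Including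
  them makes the terms small enough for the series to converge on \<open>Re s > 0\<close>.
\<close>
definition zeta_reg :: "complex \<Rightarrow> complex" where
  "zeta_reg s = 1 + (\<Sum>n. (s - 1) * of_nat (Suc n) powr - s - of_nat (Suc n) powr (1 - s) + of_nat (Suc (Suc n)) powr (1 - s))"

text \<open>With \<open>a = n + 1\<close> the term is \<open>s - 1\<close> times the integral of
  \<open>a^(-s) - t^(-s)\<close> over \<open>[a, a + 1]\<close>, and this difference gains a further
  factor \<open>1 / a\<close>. In the proof, \<open>f\<close> is a primitive of the integrand
  including the factor \<open>s - 1\<close>.\<close>

lemma norm_zeta_reg_term_le:
  assumes s: "Re s > 0"
  shows "norm ((s - 1) * of_nat (Suc n) powr - s - of_nat (Suc n) powr (1 - s) + of_nat (Suc (Suc n)) powr (1 - s))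
    \<le> norm (s - 1) * norm s * real (Suc n) powr (- Re s - 1)"
proof -
  define a where "a = real (Suc n)"
  have a: "a > 0" by (simp add: a_def)
  define f where "f = (\<lambda>t. (s - 1) * of_real a powr - s * (of_real t - of_real a) + of_real t powr (1 - s))"
  define f' where "f' = (\<lambda>t. (s - 1) * of_real a powr - s + (1 - s) * of_real t powr (1 - s - 1))"
  have "norm (f (a + 1) - f a) \<le> (norm (s - 1) * norm s * a powr (- Re s - 1)) * (a + 1 - a)"
  proof (rule norm_diff_le_derivative_bound)
    fix t assume t: "t \<in> {a..a+1}"
    show "(f has_vector_derivative f' t) (at t)"
      unfolding f_def f'_def
      by (rule has_vector_derivative_add, rule has_vector_derivative_real_field, (rule derivative_eq_intros refl)+, simp,
          rule has_vector_derivative_of_real_powr) (use t a in auto)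
    have "f' t = - (s - 1) * (of_real t powr - s - of_real a powr - s)"
      by (simp add: f'_def algebra_simps)
    also have "norm \<dots> = norm (s - 1) * norm (of_real t powr - s - of_real a powr - s)"
      by (simp add: norm_mult norm_minus_commute)
    also have "\<dots> \<le> norm (s - 1) * (norm s * a powr (- Re s - 1) * (t - a))"
      by (intro mult_left_mono norm_of_real_powr_diff_le) (use t a s in auto)
    also have "\<dots> \<le> norm (s - 1) * (norm s * a powr (- Re s - 1) * 1)"
      by (intro mult_left_mono) (use t in auto)
    finally show "norm (f' t) \<le> norm (s - 1) * norm s * a powr (- Re s - 1)" by (simp add: mult_ac)
  qed auto
  also have "f (a + 1) - f a = (s - 1) * of_nat (Suc n) powr - s - of_nat (Suc n) powr (1 - s) + of_nat (Suc (Suc n)) powr (1 - s)"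
    by (simp add: f_def a_def add_ac)
  finally show ?thesis by (simp add: a_def)
qed

lemma zeta_reg_holomorphic: "zeta_reg holomorphic_on {s. Re s > 0}"
proof -
  define S where "S = {s. Re s > 0}"
  define f where "f = (\<lambda>n s. (s - 1) * of_nat (Suc n) powr - s - of_nat (Suc n) powr (1 - s) + of_nat (Suc (Suc n)) powr (1 - s) :: complex)"
  have S: "open S" unfolding S_def by (rule open_halfspace_Re_gt)
  have "f n holomorphic_on UNIV" for n
    unfolding f_def by (intro holomorphic_intros) (auto simp del: of_nat_Suc)
  hence der: "(f n has_field_derivative deriv (f n) s) (at s)" for n s
    using holomorphic_derivI open_UNIV UNIV_I by blast
  have "\<exists>g g'. \<forall>x\<in>S. (\<lambda>n. f n x) sums g x \<and>
      (\<lambda>n. deriv (f n) x) sums g' x \<and> (g has_field_derivative g' x) (at x)"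
  proof (rule series_and_derivative_comparison_local[OF S der])
    fix x assume x: "x \<in> S"
    define d where "d = Re x / 2"
    have d: "d > 0" using x by (simp add: d_def S_def)
    define B where "B = (norm x + d + 1) * (norm x + d)"
    have "norm (f n y) \<le> B * real (Suc n) powr - (1 + d)" if y: "y \<in> ball x d" for n y
    proof -
      have 1: "\<bar>Re (x - y)\<bar> < d" using that abs_Re_le_cmod[of "x - y"] by (simp add: dist_norm)
      moreover have "2 * d = Re x" by (simp add: d_def)
      ultimately have 2: "Re y \<ge> d" by auto
      have 3: "norm y \<le> norm x + d"
        using y norm_triangle_ineq2[of y x] by (simp add: dist_norm norm_minus_commute)
      have 4: "norm (y - 1) \<le> norm x + d + 1"
        using 3 norm_triangle_ineq4[of y 1] by simp
      have "norm (f n y) \<le> norm (y - 1) * norm y * real (Suc n) powr (- Re y - 1)"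
        unfolding f_def by (rule norm_zeta_reg_term_le) (use 2 d in auto)
      also have "\<dots> \<le> B * real (Suc n) powr - (1 + d)"
        unfolding B_def by (intro mult_mono 3 4 powr_mono) (use 2 d in auto)
      finally show ?thesis .
    qed
    hence "\<forall>\<^sub>F n in sequentially. \<forall>y\<in>ball x d \<inter> S. norm (f n y) \<le> B * real (Suc n) powr - (1 + d)"
      by (intro always_eventually) blast
    moreover have "summable (\<lambda>n. B * real (Suc n) powr - (1 + d))"
      by (rule summable_mult, rule summable_powr_Suc) (use d in auto)
    ultimately show "\<exists>d h. 0 < d \<and> summable h \<and> (\<forall>\<^sub>F n in sequentially. \<forall>y\<in>ball x d \<inter> S. norm (f n y) \<le> h n)"
      using d by (intro exI[of _ d] exI[of _ "\<lambda>n. B * real (Suc n) powr - (1 + d)"] conjI)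
  qed
  then obtain g g' where g: "\<forall>x\<in>S. (\<lambda>n. f n x) sums g x \<and>
      (\<lambda>n. deriv (f n) x) sums g' x \<and> (g has_field_derivative g' x) (at x)" by (elim exE)
  have "(\<lambda>s. 1 + g s) holomorphic_on S"
    by (intro holomorphic_intros) (use g S in \<open>auto simp: holomorphic_on_open\<close>)
  moreover have "zeta_reg s = 1 + g s" if "s \<in> S" for s
    using g that unfolding zeta_reg_def f_def by (auto simp: sums_iff)
  ultimately show ?thesis unfolding S_def [symmetric] by (simp cong: holomorphic_cong)
qed

text \<open>Every term of the series vanishes at \<open>s = 1\<close>; the value is the residue of
  \<open>\<zeta>\<close>.\<close>

lemma zeta_reg_1 [simp]: "zeta_reg 1 = 1"
  by (simp add: zeta_reg_def del: of_nat_Suc)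

lemma of_nat_Suc_powr_tendsto_0:
  assumes "Re z < 0"
  shows "(\<lambda>n. of_nat (Suc n) powr z :: complex) \<longlonglongrightarrow> 0"
proof (rule tendsto_norm_zero_cancel)
  show "(\<lambda>n. norm (of_nat (Suc n) powr z :: complex)) \<longlonglongrightarrow> 0"
    unfolding norm_of_nat_powr
    by (rule tendsto_neg_powr[OF assms])
      (rule filterlim_compose[OF filterlim_real_sequentially filterlim_Suc])
qed

lemma zeta_reg_eq:
  assumes s: "Re s > 1"
  shows "zeta_reg s = (s - 1) * zeta_series s"
proof -
  define f where "f = (\<lambda>n. (s - 1) * of_nat (Suc n) powr - s - of_nat (Suc n) powr (1 - s) + of_nat (Suc (Suc n)) powr (1 - s) :: complex)"
  have "(\<Sum>n<N. f n) = (s - 1) * (\<Sum>n<N. of_nat (Suc n) powr - s) + (of_nat (Suc N) powr (1 - s) - 1)" for N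
    by (induction N) (auto simp: f_def algebra_simps simp del: of_nat_Suc, simp add: powr_def)
  moreover have "(\<lambda>N. (s - 1) * (\<Sum>n<N. of_nat (Suc n) powr - s) + (of_nat (Suc N) powr (1 - s) - 1)) \<longlonglongrightarrow>
      (s - 1) * zeta_series s + (0 - 1)"
    using zeta_series_sums[OF s] s unfolding sums_def
    by (intro tendsto_intros of_nat_Suc_powr_tendsto_0) auto
  ultimately have "f sums ((s - 1) * zeta_series s + (0 - 1))"
    unfolding sums_def by simp
  thus ?thesis unfolding zeta_reg_def f_def by (auto simp: sums_iff)
qed

text \<open>This is the logarithmic derivative \<open>1 / (s - 1) - mangoldt_series s\<close>,
  multiplied out: the identity serves to prove that \<open>zeta_reg\<close> has no zeros, so
  division by it is not yet available.\<close>

lemma zeta_reg_deriv: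
  assumes s: "Re s > 1"
  shows "(s - 1) * deriv zeta_reg s = zeta_reg s * (1 - (s - 1) * mangoldt_series s)"
proof -
  have "((\<lambda>s. (s - 1) * zeta_series s) has_field_derivative
      (s - 1) * - (mangoldt_series s * zeta_series s) + zeta_series s) (at s)"
    by (rule derivative_eq_intros zeta_series_derivative s refl)+ (simp add: algebra_simps)
  hence "(zeta_reg has_field_derivative (s - 1) * - (mangoldt_series s * zeta_series s) + zeta_series s) (at s)"
    by (rule has_field_derivative_transform_within_open[where S = "{s. Re s > 1}"])
      (use s in \<open>auto simp: zeta_reg_eq open_halfspace_Re_gt\<close>)
  hence d: "deriv zeta_reg s = (s - 1) * - (mangoldt_series s * zeta_series s) + zeta_series s"
    by (rule DERIV_imp_deriv)
  show ?thesis unfolding d zeta_reg_eq[OF s] by (simp add: algebra_simps)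
qed

section \<open>Non-vanishing on the closed half plane\<close>

text \<open>Factoring \<open>f\<close> as \<open>(s - a)^k g\<close> with
  \<open>g a \<noteq> 0\<close> shows that the limit is the order of vanishing. That it is a natural
  number is decisive for the 3-4-1 argument.\<close>

lemma holomorphic_log_deriv_order:
  assumes f: "f holomorphic_on S" and S: "open S" "connected S" "a \<in> S" and nc: "f a = 0 \<Longrightarrow> \<not> f constant_on S"
  obtains k :: nat where "k = 0 \<longleftrightarrow> f a \<noteq> 0" "((\<lambda>s. (s - a) * deriv f s / f s) \<longlongrightarrow> of_nat k) (at a)"
    "\<forall>\<^sub>F s in at a. f s \<noteq> 0"
proof (cases "f a = 0")
  case False
  have cont: "isCont f a" "isCont (deriv f) a"
    using f S holomorphic_deriv[OF f S(1)]
    by (auto simp: continuous_on_eq_continuous_at dest!: holomorphic_on_imp_continuous_on)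
  have "((\<lambda>s. (s - a) * deriv f s / f s) \<longlongrightarrow> (a - a) * deriv f a / f a) (at a)"
    using cont False unfolding isCont_def by (intro tendsto_intros)
  moreover have "\<forall>\<^sub>F s in at a. f s \<noteq> 0"
    using cont(1) False unfolding isCont_def by (rule tendsto_imp_eventually_ne)
  ultimately show ?thesis using that[of 0] False by simp
next
  case True
  obtain g r n where gr: "0 < n" "0 < r" "ball a r \<subseteq> S" "g holomorphic_on ball a r"
      "\<And>w. w \<in> ball a r \<Longrightarrow> f w = (w - a) ^ n * g w" "\<And>w. w \<in> ball a r \<Longrightarrow> g w \<noteq> 0"
    using holomorphic_factor_zero_nonconstant[OF f S True nc[OF True]] by metis
  have cont: "isCont g a" "isCont (deriv g) a"
    using gr holomorphic_deriv[OF gr(4)]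
    by (auto simp: continuous_on_eq_continuous_at dest!: holomorphic_on_imp_continuous_on)
  have ev: "\<forall>\<^sub>F s in at a. s \<in> ball a r - {a}"
    using gr(2) by (intro eventually_at_in_open) auto
  have "((\<lambda>s. of_nat n + (s - a) * deriv g s / g s) \<longlongrightarrow> of_nat n + (a - a) * deriv g a / g a) (at a)"
    using cont gr(6)[of a] gr(2) unfolding isCont_def by (intro tendsto_intros) auto
  moreover have "\<forall>\<^sub>F s in at a. of_nat n + (s - a) * deriv g s / g s = (s - a) * deriv f s / f s"
    using ev
  proof eventually_elim
    case (elim s)
    have "(g has_field_derivative deriv g s) (at s)"
      using elim gr(4) holomorphic_derivI open_ball by blast
    hence "((\<lambda>w. (w - a) ^ n * g w) has_field_derivative
        (of_nat n * (s - a) ^ (n - 1)) * g s + (s - a) ^ n * deriv g s) (at s)"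
      by (auto intro!: derivative_eq_intros)
    hence "(f has_field_derivative (of_nat n * (s - a) ^ (n - 1)) * g s + (s - a) ^ n * deriv g s) (at s)"
      by (rule has_field_derivative_transform_within_open[where S = "ball a r"]) (use elim gr in auto)
    hence d: "deriv f s = (of_nat n * (s - a) ^ (n - 1)) * g s + (s - a) ^ n * deriv g s"
      by (rule DERIV_imp_deriv)
    obtain m where n: "n = Suc m" using gr(1) by (cases n) auto
    define x where "x = s - a"
    have "x \<noteq> 0" "f s = x ^ Suc m * g s" "g s \<noteq> 0"
      using elim gr(5,6)[of s] by (auto simp: x_def n)
    thus ?case unfolding d n x_def [symmetric] by (simp add: field_simps)
  qed
  ultimately have "((\<lambda>s. (s - a) * deriv f s / f s) \<longlongrightarrow> of_nat n) (at a)"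
    by (simp add: tendsto_cong)
  moreover have "\<forall>\<^sub>F s in at a. f s \<noteq> 0"
    using ev by eventually_elim (use gr in auto)
  ultimately show ?thesis using that[of n] gr(1) True by simp
qed

text \<open>Since \<open>mangoldt_series s\<close> is \<open>1 / (s - 1)\<close> minus the
  logarithmic derivative of \<open>zeta_reg\<close>, its residue at \<open>a\<close> is the
  contribution 1 of the pole at \<open>a = 1\<close> minus the order of vanishing. The approach is
  from the right, where the Dirichlet series converges.\<close>

lemma mangoldt_series_residue:
  assumes a: "Re a \<ge> 1"
  shows "\<exists>k::nat. (k = 0 \<longleftrightarrow> zeta_reg a \<noteq> 0) \<and>
    ((\<lambda>\<epsilon>. of_real \<epsilon> * mangoldt_series (a + of_real \<epsilon>)) \<longlongrightarrow> (if a = 1 then 1 else 0) - of_nat k) (at_right 0)"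
proof -
  have nc: "\<not> zeta_reg constant_on {s. Re s > 0}" if "zeta_reg a = 0"
  proof
    assume "zeta_reg constant_on {s. Re s > 0}"
    then obtain c where c: "\<And>s. Re s > 0 \<Longrightarrow> zeta_reg s = c" by (auto simp: constant_on_def)
    show False using c[of 1] c[of a] that a by simp
  qed
  obtain k :: nat where k: "k = 0 \<longleftrightarrow> zeta_reg a \<noteq> 0"
      "((\<lambda>s. (s - a) * deriv zeta_reg s / zeta_reg s) \<longlongrightarrow> of_nat k) (at a)"
      "\<forall>\<^sub>F s in at a. zeta_reg s \<noteq> 0"
    by (rule holomorphic_log_deriv_order[OF zeta_reg_holomorphic _ _ _ nc])
      (use a in \<open>auto simp: open_halfspace_Re_gt convex_halfspace_Re_gt intro: convex_connected\<close>)
  have lim: "filterlim (\<lambda>\<epsilon>. a + of_real \<epsilon>) (at a) (at_right (0::real))"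
  proof (rule filterlim_atI)
    show "((\<lambda>\<epsilon>. a + of_real \<epsilon>) \<longlongrightarrow> a) (at_right (0::real))"
      by (rule tendsto_eq_intros refl | simp)+
    show "\<forall>\<^sub>F \<epsilon> in at_right (0::real). a + of_real \<epsilon> \<noteq> a"
      using eventually_at_right_less[of "0::real"] by eventually_elim auto
  qed
  have l1: "((\<lambda>\<epsilon>. of_real \<epsilon> * deriv zeta_reg (a + of_real \<epsilon>) / zeta_reg (a + of_real \<epsilon>)) \<longlongrightarrow> of_nat k) (at_right (0::real))"
    using filterlim_compose[OF k(2) lim] by simp
  have l2: "((\<lambda>\<epsilon>. of_real \<epsilon> / (a + of_real \<epsilon> - 1)) \<longlongrightarrow> (if a = 1 then 1 else 0)) (at_right (0::real))"
  proof (cases "a = 1")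
    case True
    have "\<forall>\<^sub>F \<epsilon> in at_right (0::real). of_real \<epsilon> / (a + of_real \<epsilon> - 1) = 1"
      using eventually_at_right_less[of "0::real"] by eventually_elim (use True in auto)
    thus ?thesis unfolding if_P[OF True] by (rule tendsto_eventually)
  next
    case False
    have "((\<lambda>\<epsilon>. of_real \<epsilon> / (a + of_real \<epsilon> - 1)) \<longlongrightarrow> of_real 0 / (a + of_real 0 - 1)) (at_right (0::real))"
      by (intro tendsto_intros) (use False in auto)
    thus ?thesis using False by simp
  qed
  have "\<forall>\<^sub>F \<epsilon> in at_right (0::real). of_real \<epsilon> / (a + of_real \<epsilon> - 1) -
      of_real \<epsilon> * deriv zeta_reg (a + of_real \<epsilon>) / zeta_reg (a + of_real \<epsilon>) = of_real \<epsilon> * mangoldt_series (a + of_real \<epsilon>)"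
    using eventually_at_right_less[of "0::real"] filterlim_iff[THEN iffD1, OF lim, rule_format, OF k(3)]
  proof eventually_elim
    case (elim \<epsilon>)
    define s where "s = a + of_real \<epsilon>"
    have s: "Re s > 1" using elim a by (simp add: s_def)
    hence "s \<noteq> 1" by auto
    have "(s - 1) * deriv zeta_reg s = (s - 1) * (zeta_reg s * (1 / (s - 1) - mangoldt_series s))"
      using \<open>s \<noteq> 1\<close> unfolding zeta_reg_deriv[OF s] by (simp add: field_simps)
    hence "deriv zeta_reg s = zeta_reg s * (1 / (s - 1) - mangoldt_series s)"
      using \<open>s \<noteq> 1\<close> by simp
    hence "of_real \<epsilon> * deriv zeta_reg s / zeta_reg s = of_real \<epsilon> * (1 / (s - 1) - mangoldt_series s)"
      using elim(2) unfolding s_def [symmetric] by simp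
    thus ?case
      unfolding s_def [symmetric] by (simp add: algebra_simps)
  qed
  with tendsto_diff[OF l2 l1]
  have "((\<lambda>\<epsilon>. of_real \<epsilon> * mangoldt_series (a + of_real \<epsilon>)) \<longlongrightarrow> (if a = 1 then 1 else 0) - of_nat k) (at_right 0)"
    by (rule Lim_transform_eventually)
  with k(1) show ?thesis by (intro exI[of _ k] conjI)
qed

text \<open>With \<open>c = cos (t * ln n)\<close>, the \<open>n\<close>-th term carries the factor
  \<open>3 + 4 * c + (2 * c^2 - 1) = 2 * (c + 1)^2\<close>.\<close>

lemma mangoldt_series_3_4_1:
  fixes \<sigma> t :: real
  assumes "\<sigma> > 1"
  shows "3 * Re (mangoldt_series \<sigma>) + 4 * Re (mangoldt_series (\<sigma> + \<i> * t)) + Re (mangoldt_series (\<sigma> + \<i> * (2 * t))) \<ge> 0"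
proof -
  have sums: "(\<lambda>n. mangoldt (Suc n) * real (Suc n) powr - \<sigma> * cos (u * ln (real (Suc n)))) sums Re (mangoldt_series (\<sigma> + \<i> * u))" for u :: real
  proof -
    have "Re (mangoldt (Suc n) * of_nat (Suc n) powr - (\<sigma> + \<i> * u)) = mangoldt (Suc n) * real (Suc n) powr - \<sigma> * cos (u * ln (real (Suc n)))" for n
    proof -
      have "of_nat (Suc n) powr - (\<sigma> + \<i> * u) = exp (of_real (- \<sigma> * ln (real (Suc n))) + \<i> * of_real (- u * ln (real (Suc n))))"
        by (simp add: powr_def Ln_of_nat algebra_simps del: of_nat_Suc)
      hence "Re (of_nat (Suc n) powr - (\<sigma> + \<i> * u)) = real (Suc n) powr - \<sigma> * cos (u * ln (real (Suc n)))"
        by (simp add: Re_exp powr_def del: of_nat_Suc)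
      thus ?thesis by (simp only: times_complex.sel Re_mangoldt Im_mangoldt mult_zero_left diff_zero mult.assoc)
    qed
    thus ?thesis
      using sums_Re[OF mangoldt_series_sums[of "\<sigma> + \<i> * u"]] assms by (simp only:) simp
  qed
  have "(\<lambda>n. 3 * (mangoldt (Suc n) * real (Suc n) powr - \<sigma> * cos (0 * ln (real (Suc n)))) +
      4 * (mangoldt (Suc n) * real (Suc n) powr - \<sigma> * cos (t * ln (real (Suc n)))) +
      mangoldt (Suc n) * real (Suc n) powr - \<sigma> * cos (2 * t * ln (real (Suc n)))) sums
      (3 * Re (mangoldt_series (\<sigma> + \<i> * complex_of_real 0)) + 4 * Re (mangoldt_series (\<sigma> + \<i> * t)) + Re (mangoldt_series (\<sigma> + \<i> * complex_of_real (2 * t))))"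
    by (intro sums_add sums_mult sums)
  hence "0 \<le> (3 * Re (mangoldt_series (\<sigma> + \<i> * complex_of_real 0)) + 4 * Re (mangoldt_series (\<sigma> + \<i> * t)) + Re (mangoldt_series (\<sigma> + \<i> * complex_of_real (2 * t))))"
  proof (rule sums_le[OF _ sums_zero, rotated])
    fix n :: nat
    define c where "c = cos (t * ln (real (Suc n)))"
    have c2: "cos (2 * t * ln (real (Suc n))) = 2 * c\<^sup>2 - 1"
      unfolding c_def by (metis cos_double_cos mult.assoc)
    have "0 \<le> mangoldt (Suc n) * real (Suc n) powr - \<sigma> * (2 * (c + 1)\<^sup>2)"
      by (intro mult_nonneg_nonneg mangoldt_nonneg) auto
    also have "\<dots> = 3 * (mangoldt (Suc n) * real (Suc n) powr - \<sigma> * cos (0 * ln (real (Suc n)))) +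
      4 * (mangoldt (Suc n) * real (Suc n) powr - \<sigma> * cos (t * ln (real (Suc n)))) +
      mangoldt (Suc n) * real (Suc n) powr - \<sigma> * cos (2 * t * ln (real (Suc n)))"
      unfolding c2 unfolding c_def [symmetric] by (simp add: power2_eq_square algebra_simps)
    finally show "0 \<le> \<dots>" .
  qed
  thus ?thesis by simp
qed

text \<open>For \<open>Re a > 1\<close> the Dirichlet series stays bounded near \<open>a\<close>, so
  the residue, and with it the order of vanishing, is 0. On the line, multiplying the 3-4-1
  inequality by \<open>\<epsilon>\<close> and letting \<open>\<epsilon>\<close> tend to 0 gives
  \<open>3 - 4 * k - m \<ge> 0\<close> for the orders \<open>k\<close> at
  \<open>a = 1 + \<i> * t\<close> and \<open>m\<close> at \<open>1 + \<i> * (2 * t)\<close>, so the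
  natural number \<open>k\<close> is 0.\<close>

lemma zeta_reg_nonzero:
  assumes a: "Re a \<ge> 1"
  shows "zeta_reg a \<noteq> 0"
proof (cases "Re a = 1")
  case False
  obtain k :: nat where k: "k = 0 \<longleftrightarrow> zeta_reg a \<noteq> 0"
    "((\<lambda>\<epsilon>. of_real \<epsilon> * mangoldt_series (a + of_real \<epsilon>)) \<longlongrightarrow> (if a = 1 then 1 else 0) - of_nat k) (at_right 0)"
    using mangoldt_series_residue[OF a] by (elim exE conjE)
  have a1: "Re a > 1" using a False by simp
  define C where "C = (\<Sum>n. ln (real (Suc n)) * real (Suc n) powr - Re a)"
  have "norm (mangoldt_series (a + of_real \<epsilon>)) \<le> C" if "\<epsilon> \<ge> 0" for \<epsilon>
  proof -
    have "norm (mangoldt_series (a + of_real \<epsilon>)) \<le> (\<Sum>n. norm (mangoldt (Suc n) * of_nat (Suc n) powr - (a + of_real \<epsilon>) :: complex))"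
      unfolding mangoldt_series_def by (rule summable_norm[OF summable_norm_mangoldt_series]) (use a1 that in auto)
    also have "\<dots> \<le> C" unfolding C_def
      by (intro suminf_le norm_mangoldt_term_le summable_norm_mangoldt_series summable_ln_powr_Suc) (use a1 that in auto)
    finally show ?thesis .
  qed
  hence "\<forall>\<^sub>F \<epsilon> in at_right 0. norm (of_real \<epsilon> * mangoldt_series (a + of_real \<epsilon>)) \<le> \<epsilon> * C"
    using eventually_at_right_less[of "0::real"]
    by (auto simp: norm_mult elim!: eventually_mono intro!: mult_left_mono)
  moreover have "((\<lambda>\<epsilon>. \<epsilon> * C) \<longlongrightarrow> 0) (at_right 0)"
    by (rule tendsto_eq_intros refl | simp)+
  ultimately have "((\<lambda>\<epsilon>. of_real \<epsilon> * mangoldt_series (a + of_real \<epsilon>)) \<longlongrightarrow> 0) (at_right 0)"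
    by (rule Lim_null_comparison)
  from tendsto_unique[OF _ k(2) this] have "k = 0" using a1 by (auto split: if_splits)
  with k show ?thesis by simp
next
  case True
  show ?thesis
  proof (cases "a = 1")
    case False
    define t where "t = Im a"
    have a_eq: "a = 1 + \<i> * t" using True by (simp add: t_def complex_eq_iff)
    have t: "t \<noteq> 0" using False a_eq by auto
    have R1: "1 \<le> Re 1" and R2: "1 \<le> Re (1 + \<i> * (2 * t))" by simp_all
    obtain k1 :: nat where k1: "k1 = 0 \<longleftrightarrow> zeta_reg 1 \<noteq> 0"
      "((\<lambda>\<epsilon>. of_real \<epsilon> * mangoldt_series (1 + of_real \<epsilon>)) \<longlongrightarrow> 1 - of_nat k1) (at_right 0)"
      using mangoldt_series_residue[of 1, OF R1] unfolding if_P[OF refl] by (elim exE conjE)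
    obtain k :: nat where k: "k = 0 \<longleftrightarrow> zeta_reg a \<noteq> 0"
      "((\<lambda>\<epsilon>. of_real \<epsilon> * mangoldt_series (a + of_real \<epsilon>)) \<longlongrightarrow> 0 - of_nat k) (at_right 0)"
      using mangoldt_series_residue[OF a] unfolding if_not_P[OF False] by (elim exE conjE)
    have ne: "1 + \<i> * (2 * t) \<noteq> 1" using t by simp
    obtain m :: nat where m: 
      "((\<lambda>\<epsilon>. of_real \<epsilon> * mangoldt_series (1 + \<i> * (2 * t) + of_real \<epsilon>)) \<longlongrightarrow> 0 - of_nat m) (at_right 0)"
      using mangoldt_series_residue[OF R2] unfolding if_not_P[OF ne] by (elim exE conjE)
    have "((\<lambda>\<epsilon>. 3 * Re (of_real \<epsilon> * mangoldt_series (1 + of_real \<epsilon>)) + 4 * Re (of_real \<epsilon> * mangoldt_series (a + of_real \<epsilon>))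
        + Re (of_real \<epsilon> * mangoldt_series (1 + \<i> * (2 * t) + of_real \<epsilon>))) \<longlongrightarrow>
        3 * Re (1 - of_nat k1) + 4 * Re (0 - of_nat k) + Re (0 - of_nat m)) (at_right 0)"
      by (intro tendsto_intros k1 k m)
    moreover have "\<forall>\<^sub>F \<epsilon> in at_right 0. 0 \<le> 3 * Re (of_real \<epsilon> * mangoldt_series (1 + of_real \<epsilon>)) + 4 * Re (of_real \<epsilon> * mangoldt_series (a + of_real \<epsilon>))
        + Re (of_real \<epsilon> * mangoldt_series (1 + \<i> * (2 * t) + of_real \<epsilon>))"
      using eventually_at_right_less[of "0::real"]
    proof eventually_elim
      case (elim \<epsilon>)
      have "0 \<le> \<epsilon> * (3 * Re (mangoldt_series (1 + \<epsilon>)) + 4 * Re (mangoldt_series (1 + \<epsilon> + \<i> * t)) + Re (mangoldt_series (1 + \<epsilon> + \<i> * (2 * t))))"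
        using mangoldt_series_3_4_1[of "1 + \<epsilon>" t] elim by (intro mult_nonneg_nonneg) auto
      thus ?case by (simp add: a_eq algebra_simps)
    qed
    ultimately have "0 \<le> 3 * Re (1 - of_nat k1) + 4 * Re (0 - of_nat k) + Re (0 - of_nat m)"
      by (rule tendsto_lowerbound) simp
    moreover have "k1 = 0" using k1 by simp
    ultimately have "k = 0" by simp
    thus ?thesis using k by simp
  qed simp
qed

section \<open>Chebyshev's function\<close>

definition chebyshev_psi :: "nat \<Rightarrow> real" where
  "chebyshev_psi n = (\<Sum>k=1..n. mangoldt k)"

lemma chebyshev_psi_0 [simp]: "chebyshev_psi 0 = 0"
  by (simp add: chebyshev_psi_def)

lemma chebyshev_psi_Suc: "chebyshev_psi (Suc n) = chebyshev_psi n + mangoldt (Suc n)"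
  by (simp add: chebyshev_psi_def)

lemma chebyshev_psi_mono: "m \<le> n \<Longrightarrow> chebyshev_psi m \<le> chebyshev_psi n"
  unfolding chebyshev_psi_def by (intro sum_mono2) (auto simp: mangoldt_nonneg)

lemma chebyshev_psi_nonneg: "chebyshev_psi n \<ge> 0"
  unfolding chebyshev_psi_def by (intro sum_nonneg mangoldt_nonneg)

text \<open>Passing from \<open>n\<close> to \<open>n + 1\<close> raises \<open>n div d\<close>
  exactly when \<open>d\<close> divides \<open>n + 1\<close>, and these \<open>d\<close> contribute
  \<open>ln (n + 1)\<close>. The free upper limit \<open>N\<close> lets the formulas for
  \<open>n\<close> and \<open>2 * n\<close> be subtracted over a common range.\<close>

lemma ln_fact_eq_sum_mangoldt:
  "n \<le> N \<Longrightarrow> ln (fact n :: real) = (\<Sum>d=1..N. mangoldt d * real (n div d))"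
proof (induction n)
  case (Suc n)
  have "(\<Sum>d=1..N. mangoldt d * real (Suc n div d)) =
      (\<Sum>d=1..N. mangoldt d * real (n div d) + (if d dvd Suc n then mangoldt d else 0))"
    by (intro sum.cong) (auto simp: div_Suc algebra_simps mod_eq_0_iff_dvd)
  also have "\<dots> = ln (fact n) + (\<Sum>d=1..N. if d dvd Suc n then mangoldt d else 0)"
    using Suc by (simp add: sum.distrib)
  also have "(\<Sum>d=1..N. if d dvd Suc n then mangoldt d else 0) = (\<Sum>d | d dvd Suc n. mangoldt d :: real)"
  proof -
    have "{d \<in> {1..N}. d dvd Suc n} = {d. d dvd Suc n}"
      using Suc.prems by (auto dest: dvd_imp_le intro!: Suc_leI Nat.gr0I)
    thus ?thesis by (simp add: sum.inter_filter [symmetric])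
  qed
  also have "\<dots> = ln (real (Suc n))"
    by (subst mangoldt_sum) auto
  also have "ln (fact n) + ln (real (Suc n)) = ln (fact (Suc n))"
    by (simp add: ln_mult mult.commute del: of_nat_Suc) 
  finally show ?case by simp
qed simp

text \<open>Chebyshev's argument: in the expansion of \<open>ln (2 * n choose n)\<close>, the
  coefficient \<open>2 * n div d - 2 * (n div d)\<close> of \<open>mangoldt d\<close> is never
  negative and equals 1 for \<open>n < d \<le> 2 * n\<close>, while the binomial coefficient is at
  most \<open>2^(2 * n)\<close>.\<close>

lemma chebyshev_psi_double_le: "chebyshev_psi (2 * n) \<le> chebyshev_psi n + 2 * real n"
proof -
  have "chebyshev_psi (2 * n) - chebyshev_psi n = (\<Sum>d=Suc n..2*n. mangoldt d)"
    unfolding chebyshev_psi_def using sum.ub_add_nat[of 1 n "mangoldt :: nat \<Rightarrow> real" n]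
    by (simp add: mult_2)
  also have "\<dots> \<le> (\<Sum>d=Suc n..2*n. mangoldt d * (real (2 * n div d) - 2 * real (n div d)))"
  proof (rule sum_mono)
    fix d assume d: "d \<in> {Suc n..2*n}"
    hence "n div d = 0" "2 * n div d = 1"
      by (auto simp: div_eq_0_iff intro!: div_nat_eqI)
    thus "mangoldt d \<le> mangoldt d * (real (2 * n div d) - 2 * real (n div d))" by simp
  qed
  also have "\<dots> \<le> (\<Sum>d=1..2*n. mangoldt d * (real (2 * n div d) - 2 * real (n div d)))"
  proof (rule sum_mono2)
    fix d
    have "2 * (n div d) \<le> 2 * n div d"
    proof (cases "d = 0")
      case False
      have "2 * (n div d) * d \<le> 2 * n" by simp
      thus ?thesis using False by (simp add: less_eq_div_iff_mult_less_eq)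
    qed auto
    hence "real (2 * (n div d)) \<le> real (2 * n div d)" by (simp only: of_nat_le_iff)
    thus "0 \<le> mangoldt d * (real (2 * n div d) - 2 * real (n div d))"
      by (intro mult_nonneg_nonneg mangoldt_nonneg) simp
  qed auto
  also have "\<dots> = ln (fact (2 * n)) - 2 * ln (fact n)"
    unfolding ln_fact_eq_sum_mangoldt[of "2 * n" "2 * n", OF order_refl]
      ln_fact_eq_sum_mangoldt[of n "2 * n", OF le_add1[of n n, folded mult_2]]
    by (simp add: right_diff_distrib sum_subtractf sum_distrib_left mult.left_commute)
  also have "\<dots> = ln (real (2 * n choose n))"
    by (simp add: binomial_fact ln_div ln_mult)
  also have "\<dots> \<le> ln (2 ^ (2 * n))"
  proof -
    have "2 * n choose n \<le> 2 ^ (2 * n)" by (rule binomial_le_pow2)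
    hence "real (2 * n choose n) \<le> real (2 ^ (2 * n))" by (simp only: of_nat_le_iff)
    thus ?thesis by simp
  qed
  also have "\<dots> = 2 * real n * ln 2" by (simp add: ln_realpow)
  also have "\<dots> \<le> 2 * real n * 1" by (intro mult_left_mono) (use ln_2_less_1 in auto)
  finally show ?thesis by simp
qed

text \<open>Any linear bound would serve. Halving with \<open>m\<close> the rounded-up half of
  \<open>n\<close> yields \<open>8 * m \<le> 4 * n + 4\<close>, which is at most
  \<open>6 * n\<close> as soon as \<open>n \<ge> 2\<close>.\<close>

lemma chebyshev_psi_le: "chebyshev_psi n \<le> 6 * real n"
proof (induction n rule: less_induct)
  case (less n)
  show ?case
  proof (cases "n \<le> 1")
    case True
    hence "n = 0 \<or> n = Suc 0" by auto
    thus ?thesis by (auto simp: chebyshev_psi_Suc)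
  next
    case False
    define m where "m = (n + 1) div 2"
    have m: "m < n" "n \<le> 2 * m" "2 * m \<le> n + 1" using False by (auto simp: m_def)
    have "chebyshev_psi n \<le> chebyshev_psi (2 * m)" by (rule chebyshev_psi_mono[OF m(2)])
    also have "\<dots> \<le> chebyshev_psi m + 2 * real m" by (rule chebyshev_psi_double_le)
    also have "\<dots> \<le> 6 * real m + 2 * real m" using less[OF m(1)] by simp
    also have "\<dots> \<le> 6 * real n"
    proof -
      have "8 * m \<le> 6 * n" using m False by linarith
      hence "real (8 * m) \<le> real (6 * n)" by (simp only: of_nat_le_iff)
      thus ?thesis by simp
    qed
    finally show ?thesis .
  qed
qed

text \<open>
  If \<open>F N > (1 + \<epsilon>) N\<close>, monotonicity keeps \<open>F n - n \<ge> \<epsilon> N / 2\<close> for all \<open>n\<close> between \<open>N\<close> and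
  \<open>(1 + \<epsilon> / 2) N\<close>. The sum over this range then exceeds a constant depending only on \<open>\<epsilon>\<close>, so by
  the Cauchy criterion this can happen only finitely often.
\<close>
lemma eventually_le_of_summable:
  fixes F :: "nat \<Rightarrow> real"
  assumes F: "mono F" and \<epsilon>: "\<epsilon> > 0"
    and summ: "summable (\<lambda>n. (F (Suc n) - real (Suc n)) * (1 / real (Suc n) - 1 / real (Suc (Suc n))))"
  shows "\<forall>\<^sub>F n in sequentially. F n \<le> (1 + \<epsilon>) * real n"
proof -
  \<comment> \<open>This is a lower bound for
    \<open>\<epsilon> * N / 2 * (1 / N - 1 / (N + K))\<close> when
    \<open>K \<ge> \<epsilon> * N / 4\<close>, independent of \<open>N\<close>.\<close>
  define c where "c = \<epsilon> / 2 * (1 - 1 / (1 + \<epsilon> / 4))"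
  have c: "c > 0" using \<epsilon> by (simp add: c_def field_simps)
  define h where "h = (\<lambda>n. (F (Suc n) - real (Suc n)) * (1 / real (Suc n) - 1 / real (Suc (Suc n))))"
  obtain N0 where N0: "\<And>m n. m \<ge> N0 \<Longrightarrow> norm (sum h {m..<n}) < c"
    using summ c unfolding h_def [symmetric] summable_Cauchy by blast
  \<comment> \<open>The condition \<open>N \<ge> 4 / \<epsilon>\<close> ensures that rounding
    \<open>\<epsilon> * N / 2\<close> down still leaves at least \<open>\<epsilon> * N / 4\<close>.
    The index of \<open>h\<close> is shifted, so the sum starts at \<open>N - 1\<close>, which must
    be at least \<open>N0\<close>.\<close>
  have "F N \<le> (1 + \<epsilon>) * real N" if N: "N \<ge> Suc N0" "real N \<ge> 4 / \<epsilon>" for N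
  proof (rule ccontr)
    assume "\<not> F N \<le> (1 + \<epsilon>) * real N"
    hence FN: "F N > (1 + \<epsilon>) * real N" by simp
    define K where "K = nat \<lfloor>\<epsilon> * real N / 2\<rfloor>"
    have "\<lfloor>\<epsilon> * real N / 2\<rfloor> \<ge> 0" using \<epsilon> by simp
    hence K: "real K \<le> \<epsilon> * real N / 2" "real K > \<epsilon> * real N / 2 - 1"
      unfolding K_def by linarith+
    have "\<epsilon> * real N \<ge> 4" using N(2) \<epsilon> by (simp add: field_simps)
    hence K': "real K \<ge> \<epsilon> * real N / 4" using K(2) by linarith
    obtain N' where N': "N = Suc N'" using N(1) by (cases N) auto
    have "\<epsilon> * real N / 2 * (1 / real N - 1 / real (N + K)) =
        (\<Sum>n=N'..<N' + K. \<epsilon> * real N / 2 * (1 / real (Suc n) - 1 / real (Suc (Suc n))))"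
    proof -
      have "(\<Sum>n=N'..<N' + K. 1 / real (Suc n) - 1 / real (Suc (Suc n))) = 1 / real N - 1 / real (N + K)"
        using sum_Suc_diff'[of N' "N' + K" "\<lambda>n. - (1 / real (Suc n))"] by (simp add: N')
      thus ?thesis by (simp only: sum_distrib_left [symmetric])
    qed
    also have "\<dots> \<le> (\<Sum>n=N'..<N' + K. h n)"
      unfolding h_def
    proof (intro sum_mono mult_right_mono)
      fix n assume n: "n \<in> {N'..<N' + K}"
      hence "real (Suc n) \<le> real N + real K" "N \<le> Suc n" by (auto simp: N')
      moreover have "F N \<le> F (Suc n)" by (rule monoD[OF F]) fact
      ultimately show "\<epsilon> * real N / 2 \<le> F (Suc n) - real (Suc n)"
        using FN K(1) by (simp add: algebra_simps)
    qed (auto simp: field_simps)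
    also have "\<dots> < c" using N0[of N' "N' + K"] N(1) N' by simp
    finally have "\<epsilon> * real N / 2 * (1 / real N - 1 / real (N + K)) < c" .
    moreover have "c \<le> \<epsilon> * real N / 2 * (1 / real N - 1 / real (N + K))"
    proof -
      have Npos: "real N > 0" using N' by simp
      have "real N / real (N + K) \<le> real N / (real N * (1 + \<epsilon> / 4))"
      proof (rule frac_le)
        show "0 < real N * (1 + \<epsilon> / 4)" using Npos \<epsilon> by (intro mult_pos_pos) auto
        show "real N * (1 + \<epsilon> / 4) \<le> real (N + K)" using K' by (simp add: algebra_simps)
      qed auto
      also have "\<dots> = 1 / (1 + \<epsilon> / 4)" using Npos by simp
      finally have "c \<le> \<epsilon> / 2 * (1 - real N / real (N + K))"
        unfolding c_def using \<epsilon> by (intro mult_left_mono) auto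
      also have "\<dots> = \<epsilon> * real N / 2 * (1 / real N - 1 / real (N + K))"
        using Npos by (simp add: right_diff_distrib)
      finally show ?thesis .
    qed
    ultimately show False by simp
  qed
  moreover have "\<forall>\<^sub>F N in sequentially. N \<ge> Suc N0 \<and> real N \<ge> 4 / \<epsilon>"
    by (intro eventually_conj eventually_ge_at_top filterlim_real_sequentially[THEN filterlim_at_top[THEN iffD1], rule_format])
  ultimately show ?thesis by (auto elim!: eventually_mono)
qed

section \<open>Newman's theorem for Chebyshev's function\<close>

text \<open>The derivative of \<open>t^(-(1 + z))\<close> has norm
  \<open>\<bar>1 + z\<bar> t^(- Re z - 2)\<close>. One factor \<open>1 / t\<close> is bounded by
  \<open>1 / (n + 1)\<close>, which offsets the linear growth of \<open>\<psi> n - n\<close>; the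
  remaining power integrates to the telescoping shape of Newman's hypothesis, with primitive
  \<open>\<phi>\<close>.\<close>

lemma norm_powr_Suc_diff_le:
  fixes z :: complex
  assumes x: "Re z \<noteq> 0"
  shows "real (Suc n) * norm (of_nat (Suc n) powr - (1 + z) - of_nat (Suc (Suc n)) powr - (1 + z) :: complex)
    \<le> norm (1 + z) * ((real (Suc n) powr - Re z - real (Suc (Suc n)) powr - Re z) / Re z)"
proof -
  define a where "a = real (Suc n)"
  have a: "a > 0" by (simp add: a_def)
  define f where "f = (\<lambda>t. complex_of_real t powr - (1 + z))"
  define \<phi> where "\<phi> = (\<lambda>t. - (norm (1 + z) / (a * Re z)) * t powr - Re z)"
  have "norm (f (a + 1) - f a) \<le> \<phi> (a + 1) - \<phi> a"
  proof (rule differentiable_bound_general[where f' = "\<lambda>t. - (1 + z) * complex_of_real t powr (- (1 + z) - 1)"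
        and \<phi>' = "\<lambda>t. norm (1 + z) / a * t powr (- Re z - 1)"])
    have f': "(f has_vector_derivative - (1 + z) * complex_of_real t powr (- (1 + z) - 1)) (at t)" if "t \<ge> a" for t
      unfolding f_def by (rule has_vector_derivative_of_real_powr) (use that a in auto)
    have \<phi>': "(\<phi> has_vector_derivative norm (1 + z) / a * t powr (- Re z - 1)) (at t)" if "t \<ge> a" for t
    proof -
      have "((\<lambda>t. t powr - Re z) has_real_derivative - Re z * t powr (- Re z - 1)) (at t)"
        by (rule has_real_derivative_powr) (use that a in auto)
      hence "(\<phi> has_real_derivative - (norm (1 + z) / (a * Re z)) * (- Re z * t powr (- Re z - 1))) (at t)"
        unfolding \<phi>_def by (rule DERIV_cmult)
      also have "- (norm (1 + z) / (a * Re z)) * (- Re z * t powr (- Re z - 1)) = norm (1 + z) / a * t powr (- Re z - 1)"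
        using x a by simp
      finally show ?thesis by (simp add: has_real_derivative_iff_has_vector_derivative)
    qed
    show "continuous_on {a..a + 1} f" "continuous_on {a..a + 1} \<phi>"
      using f' \<phi>' by (meson atLeastAtMost_iff continuous_at_imp_continuous_on has_vector_derivative_continuous)+
    fix t assume t: "a < t" "t < a + 1"
    show "(f has_vector_derivative - (1 + z) * complex_of_real t powr (- (1 + z) - 1)) (at t)"
      "(\<phi> has_vector_derivative norm (1 + z) / a * t powr (- Re z - 1)) (at t)"
      using f'[of t] \<phi>'[of t] t by auto
    have "norm (- (1 + z) * complex_of_real t powr (- (1 + z) - 1)) = norm (1 + z) * t powr (- Re z - 2)"
    proof -
      have "norm (complex_of_real t powr (- (1 + z) - 1)) = t powr Re (- (1 + z) - 1)"
        using t a by (subst norm_powr_real_powr) auto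
      also have "Re (- (1 + z) - 1) = - Re z - 2" by simp
      finally show ?thesis unfolding norm_mult norm_minus_cancel by (rule arg_cong)
    qed
    also have "t powr (- Re z - 2) = t powr (- Re z - 1) / t"
    proof -
      have "t powr (- Re z - 2) = t powr (- Re z - 1 + - 1)" by (simp add: algebra_simps)
      also have "\<dots> = t powr (- Re z - 1) / t"
        using t a by (subst powr_add) (simp add: powr_minus_divide)
      finally show ?thesis .
    qed
    also have "\<dots> \<le> t powr (- Re z - 1) / a"
      by (intro divide_left_mono) (use t a in auto)
    finally show "norm (- (1 + z) * complex_of_real t powr (- (1 + z) - 1)) \<le> norm (1 + z) / a * t powr (- Re z - 1)"
      by (simp add: mult_left_mono)
  qed auto
  also have "norm (f (a + 1) - f a) = norm (of_nat (Suc n) powr - (1 + z) - of_nat (Suc (Suc n)) powr - (1 + z) :: complex)"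
    by (simp add: f_def a_def norm_minus_commute add_ac)
  also have "\<phi> (a + 1) - \<phi> a = norm (1 + z) * ((a powr - Re z - (a + 1) powr - Re z) / Re z) / a"
    using x a by (simp add: \<phi>_def divide_simps) (simp add: algebra_simps)
  also have "a + 1 = real (Suc (Suc n))" by (simp add: a_def)
  finally show ?thesis by (simp only: pos_le_divide_eq[OF a] a_def [symmetric] mult.commute)
qed

lemma abs_chebyshev_psi_diff_le: "\<bar>chebyshev_psi n - real n\<bar> \<le> 6 * real n"
  using chebyshev_psi_le[of n] chebyshev_psi_nonneg[of n] by linarith

text \<open>Abel summation of the coefficients \<open>mangoldt n - 1\<close>. The boundary term is
  of order \<open>N^(1 - Re s)\<close> by Chebyshev's bound and disappears for
  \<open>Re s > 1\<close>.\<close>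

lemma mangoldt_series_minus_zeta_series_sums:
  fixes s :: complex
  assumes s: "Re s > 1"
  shows "(\<lambda>n. of_real (chebyshev_psi (Suc n) - real (Suc n)) * (of_nat (Suc n) powr - s - of_nat (Suc (Suc n)) powr - s))
    sums (mangoldt_series s - zeta_series s)"
proof -
  define A where "A = (\<lambda>n. complex_of_real (chebyshev_psi n - real n))"
  define w where "w = (\<lambda>n. of_nat (Suc n) powr - s - of_nat (Suc (Suc n)) powr - s :: complex)"
  have A_norm: "norm (A n) \<le> 6 * real n" for n
    unfolding A_def norm_of_real by (rule abs_chebyshev_psi_diff_le)
  have A_Suc: "A (Suc n) = A n + (mangoldt (Suc n) - 1)" for n
    by (simp add: A_def chebyshev_psi_Suc)
  have abel: "(\<Sum>k<N. A (Suc k) * w k) = (\<Sum>k<N. mangoldt (Suc k) * of_nat (Suc k) powr - s) - (\<Sum>k<N. of_nat (Suc k) powr - s)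
      - A N * of_nat (Suc N) powr - s" for N
  proof (induction N)
    case (Suc N)
    show ?case unfolding sum.lessThan_Suc Suc.IH unfolding w_def A_Suc[of N] by (simp add: algebra_simps del: of_nat_Suc)
  qed (simp add: A_def)
  have "(\<lambda>N. A N * of_nat (Suc N) powr - s) \<longlonglongrightarrow> 0"
  proof (rule Lim_null_comparison)
    show "\<forall>\<^sub>F N in sequentially. norm (A N * of_nat (Suc N) powr - s) \<le> 6 * norm (of_nat (Suc N) powr (1 - s) :: complex)"
    proof (rule always_eventually, rule allI)
      fix N
      have "norm (A N * of_nat (Suc N) powr - s) \<le> (6 * real (Suc N)) * real (Suc N) powr - Re s"
        unfolding norm_mult norm_of_nat_powr uminus_complex.sel
        by (intro mult_right_mono order_trans[OF A_norm]) auto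
      also have "\<dots> = 6 * (real (Suc N) powr 1 * real (Suc N) powr - Re s)" by simp
      also have "\<dots> = 6 * norm (of_nat (Suc N) powr (1 - s) :: complex)"
        unfolding norm_of_nat_powr powr_add [symmetric] by simp
      finally show "norm (A N * of_nat (Suc N) powr - s) \<le> 6 * norm (of_nat (Suc N) powr (1 - s) :: complex)" .
    qed
    show "(\<lambda>N. 6 * norm (of_nat (Suc N) powr (1 - s) :: complex)) \<longlonglongrightarrow> 0"
      by (intro tendsto_mult_right_zero tendsto_norm_zero of_nat_Suc_powr_tendsto_0) (use s in auto)
  qed
  hence "(\<lambda>N. \<Sum>k<N. A (Suc k) * w k) \<longlonglongrightarrow> mangoldt_series s - zeta_series s - 0"
    unfolding abel using mangoldt_series_sums[OF s] zeta_series_sums[OF s] unfolding sums_def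
    by (intro tendsto_diff)
  thus ?thesis unfolding sums_def A_def w_def by simp
qed

text \<open>
  The weights \<open>n\<^sup>-\<^sup>s - (n + 1)\<^sup>-\<^sup>s\<close> of the Abel summation are divided by \<open>s = 1 + z\<close>, because only then the
  bound required by Newman's theorem holds uniformly in \<open>\<bar>z\<bar>\<close>; the singularity at \<open>z = - 1\<close> is removable.
\<close>
lemma summable_chebyshev_psi:
  "summable (\<lambda>n. (chebyshev_psi (Suc n) - real (Suc n)) * (1 / real (Suc n) - 1 / real (Suc (Suc n))))"
proof -
  define A where "A = (\<lambda>n. complex_of_real (chebyshev_psi (Suc n) - real (Suc n)))"
  have A_norm: "norm (A n) \<le> 6 * real (Suc n)" for n
    unfolding A_def norm_of_real by (rule abs_chebyshev_psi_diff_le)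
  define W where "W = (\<lambda>n z. of_nat (Suc n) powr - (1 + z) - of_nat (Suc (Suc n)) powr - (1 + z) :: complex)"
  have W_hol: "W n holomorphic_on UNIV" for n
    unfolding W_def by (intro holomorphic_intros) (auto simp del: of_nat_Suc)
  have W0: "W n (- 1) = 0" for n by (simp add: W_def del: of_nat_Suc)
  define Q where "Q = (\<lambda>n z. if z = - 1 then deriv (W n) (- 1) else (W n z - W n (- 1)) / (z - (- 1)))"
  have Q_hol: "Q n holomorphic_on UNIV" for n
    unfolding Q_def by (rule pole_lemma[OF W_hol]) auto
  have Q_eq: "Q n z = W n z / (1 + z)" if "z \<noteq> - 1" for n z
    using that by (simp add: Q_def W0 add.commute)
  \<comment> \<open>Since \<open>zeta_reg 1 = 1\<close>, \<open>H\<close> continues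
    \<open>\<zeta>(s) - 1 / (s - 1)\<close>. The logarithmic derivative of \<open>zeta_reg\<close>
    contains the same pole part \<open>1 / (s - 1)\<close>, so \<open>G\<close> continues the
    difference of the two series past \<open>s = 1\<close>.\<close>
  define H where "H = (\<lambda>s. if s = 1 then deriv zeta_reg 1 else (zeta_reg s - zeta_reg 1) / (s - 1))"
  have H_hol: "H holomorphic_on {s. Re s > 0}"
    unfolding H_def by (rule pole_lemma[OF zeta_reg_holomorphic]) (simp add: interior_open open_halfspace_Re_gt)
  define G where "G = (\<lambda>s. - H s - deriv zeta_reg s / zeta_reg s)"
  define D where "D = {s. Re s > 0} \<inter> zeta_reg -` (- {0})"
  have D: "open D"
    unfolding D_def by (rule continuous_open_preimage)
      (auto simp: open_halfspace_Re_gt intro: holomorphic_on_imp_continuous_on zeta_reg_holomorphic)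
  have G_hol: "G holomorphic_on D"
    unfolding G_def D_def
    by (intro holomorphic_intros holomorphic_on_subset[OF H_hol] holomorphic_on_subset[OF zeta_reg_holomorphic]
        holomorphic_on_subset[OF holomorphic_deriv[OF zeta_reg_holomorphic]]) (auto simp: open_halfspace_Re_gt)
  have G_eq: "G s = mangoldt_series s - zeta_series s" if s: "Re s > 1" for s
  proof -
    have s1: "s - 1 \<noteq> 0" "s \<noteq> 1" using s by auto
    have "zeta_reg s \<noteq> 0" by (rule zeta_reg_nonzero) (use s in auto)
    hence "deriv zeta_reg s / zeta_reg s = (1 - (s - 1) * mangoldt_series s) / (s - 1)"
      using zeta_reg_deriv[OF s] s1 by (simp add: frac_eq_eq mult.commute)
    moreover have "H s = ((s - 1) * zeta_series s - 1) / (s - 1)"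
      using s1 by (simp add: H_def zeta_reg_eq[OF s])
    ultimately show ?thesis using s1 by (simp add: G_def diff_divide_distrib)
  qed
  define U where "U = (\<lambda>z. 1 + z) -` D"
  define f where "f = (\<lambda>z. G (1 + z) / (1 + z))"
  have U: "open U"
    unfolding U_def by (rule open_vimage[OF D]) (intro continuous_intros)
  have f_hol: "f holomorphic_on U"
    unfolding f_def
  proof (intro holomorphic_on_divide)
    have "G \<circ> (\<lambda>z. 1 + z) holomorphic_on U"
      by (rule holomorphic_on_compose) (auto simp: U_def intro!: holomorphic_intros intro: holomorphic_on_subset[OF G_hol])
    thus "(\<lambda>z. G (1 + z)) holomorphic_on U" by (simp add: o_def)
    show "1 + z \<noteq> 0" if "z \<in> U" for z
    proof -
      from that have "Re (1 + z) > 0" by (simp add: U_def D_def)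
      thus ?thesis by (metis less_irrefl zero_complex.sel(1))
    qed
  qed (intro holomorphic_intros)
  have "(\<lambda>n. A n * Q n 0) sums f 0"
  proof (rule newman_tauberian[where g = "\<lambda>n z. A n * Q n z" and C = 6 and U = U and f = f])
    show "(\<lambda>z. A n * Q n z) holomorphic_on UNIV" for n
      by (intro holomorphic_intros Q_hol)
    show "{z. Re z \<ge> 0} \<subseteq> U"
      using zeta_reg_nonzero by (auto simp: U_def D_def)
  next
    fix n and z :: complex assume z: "Re z \<noteq> 0" "norm z > 1"
    hence z1: "z \<noteq> - 1" by auto
    hence z1': "norm (1 + z) > 0" by (simp add: add_eq_0_iff)
    have "norm (A n * Q n z) \<le> 6 * real (Suc n) * (norm (W n z) / norm (1 + z))"
      unfolding Q_eq[OF z1] norm_mult norm_divide by (intro mult_right_mono A_norm) auto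
    also have "\<dots> = 6 * (real (Suc n) * norm (W n z) / norm (1 + z))" by simp
    also have "\<dots> \<le> 6 * ((real (Suc n) powr - Re z - real (Suc (Suc n)) powr - Re z) / Re z)"
    proof -
      have "real (Suc n) * norm (W n z) / norm (1 + z) \<le> (real (Suc n) powr - Re z - real (Suc (Suc n)) powr - Re z) / Re z"
        using norm_powr_Suc_diff_le[OF z(1), of n] unfolding W_def pos_divide_le_eq[OF z1'] by (simp only: mult.commute)
      thus ?thesis by (intro mult_left_mono) auto
    qed
    finally show "norm (A n * Q n z) \<le> 6 * ((real (Suc n) powr - Re z - real (Suc (Suc n)) powr - Re z) / Re z)" .
  next
    fix z :: complex assume z: "Re z > 0"
    hence "z \<noteq> - 1" by auto
    have "(\<lambda>n. A n * W n z / (1 + z)) sums (G (1 + z) / (1 + z))"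
      using mangoldt_series_minus_zeta_series_sums[of "1 + z"] G_eq[of "1 + z"] z
      unfolding A_def W_def by (intro sums_divide) simp
    thus "(\<lambda>n. A n * Q n z) sums f z"
      unfolding f_def by (simp add: Q_eq[OF \<open>z \<noteq> - 1\<close>])
  qed (use U f_hol in auto)
  moreover have "Re (A n * Q n 0) = (chebyshev_psi (Suc n) - real (Suc n)) * (1 / real (Suc n) - 1 / real (Suc (Suc n)))" for n
  proof -
    have "Q n 0 = of_real (1 / real (Suc n) - 1 / real (Suc (Suc n)))"
      by (simp add: Q_eq W_def powr_minus divide_inverse del: of_nat_Suc)
    thus ?thesis by (simp add: A_def)
  qed
  ultimately show ?thesis using sums_Re sums_summable by fastforce
qed

theorem chebyshev_psi_upper_bound:
  assumes "\<epsilon> > 0"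
  obtains C where "\<And>n. chebyshev_psi n \<le> (1 + \<epsilon>) * real n + C"
proof -
  have "\<forall>\<^sub>F n in sequentially. chebyshev_psi n \<le> (1 + \<epsilon>) * real n"
    by (rule eventually_le_of_summable[OF _ assms summable_chebyshev_psi])
      (auto intro!: monoI chebyshev_psi_mono)
  then obtain N where N: "\<And>n. n \<ge> N \<Longrightarrow> chebyshev_psi n \<le> (1 + \<epsilon>) * real n"
    by (auto simp: eventually_at_top_linorder)
  have "chebyshev_psi n \<le> (1 + \<epsilon>) * real n + chebyshev_psi N" for n
  proof (cases "n \<ge> N")
    case True
    thus ?thesis using N[of n] chebyshev_psi_nonneg[of N] by linarith
  next
    case False
    hence "chebyshev_psi n \<le> chebyshev_psi N" by (intro chebyshev_psi_mono) auto
    moreover have "0 \<le> (1 + \<epsilon>) * real n" using assms by simp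
    ultimately show ?thesis by linarith
  qed
  thus ?thesis using that by blast
qed

section \<open>Smooth solutions\<close>

lemma height_pos:
  assumes "s \<in> primitive_solutions"
  shows "height s \<ge> 1"
proof -
  obtain X Y Z where s: "s = (X, Y, Z)" by (cases s)
  have "\<bar>X\<bar> \<ge> 1" using assms by (auto simp: s primitive_solutions_def)
  thus ?thesis by (simp add: s)
qed

lemma finite_height_le: "finite {s. height s \<le> B}"
proof (rule finite_subset)
  show "{s. height s \<le> B} \<subseteq> {-B..B} \<times> {-B..B} \<times> {-B..B}" by auto
qed auto

text \<open>One of \<open>X\<close>, \<open>Y\<close> and \<open>X + Y\<close> is even.\<close>

lemma two_le_smoothness:
  assumes "s \<in> primitive_solutions"
  shows "2 \<le> smoothness s"
proof -
  obtain X Y Z where s: "s = (X, Y, Z)" by (cases s)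
  have XYZ: "X + Y = Z" "X * Y * Z \<noteq> 0" using assms by (auto simp: s primitive_solutions_def)
  have "2 dvd X * Y * Z" by (auto simp: XYZ(1) [symmetric])
  thus ?thesis
    using finite_prime_divisors[OF XYZ(2)] by (auto simp: s intro!: Max_ge)
qed

text \<open>The logarithm of the radical is the sum of \<open>ln p = mangoldt p\<close> over primes
  up to the smoothness; the other prime powers only enlarge \<open>\<psi>\<close>.\<close>

lemma rad_le_exp_chebyshev_psi:
  assumes "s \<in> primitive_solutions"
  shows "real_of_int (rad s) \<le> exp (chebyshev_psi (nat (smoothness s)))"
proof -
  obtain X Y Z where s: "s = (X, Y, Z)" by (cases s)
  have XYZ: "X * Y * Z \<noteq> 0" using assms by (auto simp: s primitive_solutions_def)
  define P where "P = {p. prime p \<and> p dvd X * Y * Z}"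
  have fin: "finite P" unfolding P_def by (rule finite_prime_divisors[OF XYZ])
  have le: "p \<le> smoothness s" if "p \<in> P" for p
    using that fin by (simp add: s P_def [symmetric])
  have pos: "p > 0" if "p \<in> P" for p using that by (auto simp: P_def prime_gt_0_int)
  have "real_of_int (rad s) = exp (\<Sum>p\<in>P. ln (real_of_int p))"
    using fin pos by (simp add: s P_def [symmetric] exp_sum of_int_prod)
  also have "(\<Sum>p\<in>P. ln (real_of_int p)) = (\<Sum>p\<in>nat ` P. mangoldt p)"
  proof (subst sum.reindex)
    show "inj_on nat P" by (intro inj_onI) (metis pos eq_nat_nat_iff less_imp_le)
    show "(\<Sum>p\<in>P. ln (real_of_int p)) = sum (mangoldt \<circ> nat) P"
      by (intro sum.cong) (auto simp: P_def prime_gt_0_int less_imp_le)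
  qed
  also have "\<dots> \<le> chebyshev_psi (nat (smoothness s))"
    unfolding chebyshev_psi_def
    by (intro sum_mono2 mangoldt_nonneg) (use le pos in \<open>force simp: nat_mono\<close>)+
  finally show ?thesis by simp
qed

lemma finite_smooth_solutions:
  assumes abc: "weak_abc \<kappa>" and \<epsilon>: "\<epsilon> > 0"
  shows "finite {s \<in> primitive_solutions. real_of_int (smoothness s) \<le> (\<kappa> - \<epsilon>) * ln (real_of_int (height s))}"
proof (cases "\<kappa> - \<epsilon> \<le> 0")
  case True
  have "{s \<in> primitive_solutions. real_of_int (smoothness s) \<le> (\<kappa> - \<epsilon>) * ln (real_of_int (height s))} = {}"
  proof (safe, goal_cases)
    case (1 X Y Z)
    have "(\<kappa> - \<epsilon>) * ln (real_of_int (height (X, Y, Z))) \<le> 0"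
      using True height_pos[OF 1(1)] by (intro mult_nonpos_nonneg) (auto simp del: height.simps)
    thus ?case using 1(2) two_le_smoothness[OF 1(1)] by linarith
  qed
  thus ?thesis by (simp only: finite.emptyI)
next
  case False
  define c where "c = \<kappa> - \<epsilon>"
  have c: "c > 0" using False by (simp add: c_def)
  \<comment> \<open>The saving \<open>\<epsilon> / 2\<close> is split evenly: with relative error
    \<open>\<epsilon> / (4 * c)\<close> the main term exceeds \<open>c * ln h\<close> by
    \<open>\<epsilon> / 4 * ln h\<close>, and the constant \<open>C\<close> is at most
    \<open>\<epsilon> / 4 * ln h\<close> once
    \<open>h \<ge> exp (4 * C / \<epsilon>)\<close>.\<close>
  obtain C where C: "\<And>n. chebyshev_psi n \<le> (1 + \<epsilon> / (4 * c)) * real n + C"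
    using chebyshev_psi_upper_bound[of "\<epsilon> / (4 * c)"] \<epsilon> c by auto
  define B where "B = \<lceil>exp (4 * C / \<epsilon>)\<rceil>"
  have "{s \<in> primitive_solutions. real_of_int (smoothness s) \<le> c * ln (real_of_int (height s))}
    \<subseteq> {s \<in> primitive_solutions. real_of_int (rad s) \<le> real_of_int (height s) powr (\<kappa> - \<epsilon> / 2)} \<union> {s. height s \<le> B}"
  proof (intro subsetI, rule ccontr)
    fix s assume "s \<in> {s \<in> primitive_solutions. real_of_int (smoothness s) \<le> c * ln (real_of_int (height s))}"
    hence s: "s \<in> primitive_solutions" "real_of_int (smoothness s) \<le> c * ln (real_of_int (height s))" by auto
    define h where "h = real_of_int (height s)"
    have h: "h \<ge> 1" using height_pos[OF s(1)] by (simp add: h_def)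
    assume contra: "s \<notin> {s \<in> primitive_solutions. real_of_int (rad s) \<le> real_of_int (height s) powr (\<kappa> - \<epsilon> / 2)} \<union> {s. height s \<le> B}"
    hence "height s > B" by auto
    hence "exp (4 * C / \<epsilon>) \<le> h" unfolding B_def h_def by linarith
    hence "4 * C / \<epsilon> \<le> ln h" using h by (simp add: ln_ge_iff)
    hence Ch: "C \<le> \<epsilon> / 4 * ln h" using \<epsilon> by (simp add: field_simps)
    have "real (nat (smoothness s)) = real_of_int (smoothness s)"
      using two_le_smoothness[OF s(1)] by simp
    hence "chebyshev_psi (nat (smoothness s)) \<le> (1 + \<epsilon> / (4 * c)) * real_of_int (smoothness s) + C"
      using C[of "nat (smoothness s)"] by simp
    also have "\<dots> \<le> (1 + \<epsilon> / (4 * c)) * (c * ln h) + \<epsilon> / 4 * ln h"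
      using s(2) \<epsilon> c Ch unfolding h_def by (intro add_mono mult_left_mono) auto
    also have "\<dots> = (\<kappa> - \<epsilon> / 2) * ln h"
      using c by (simp add: field_simps) (simp add: c_def algebra_simps)
    finally have "exp (chebyshev_psi (nat (smoothness s))) \<le> h powr (\<kappa> - \<epsilon> / 2)"
      using h by (simp add: powr_def)
    hence "real_of_int (rad s) \<le> h powr (\<kappa> - \<epsilon> / 2)"
      using rad_le_exp_chebyshev_psi[OF s(1)] by linarith
    thus False using contra s(1) by (simp add: h_def)
  qed
  moreover have "finite {s \<in> primitive_solutions. real_of_int (rad s) \<le> real_of_int (height s) powr (\<kappa> - \<epsilon> / 2)}"
    using abc \<epsilon> unfolding weak_abc_def by (meson half_gt_zero)
  ultimately show ?thesis
    unfolding c_def using finite_height_le finite_subset by blast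
qed

lemma prod_prime_divisors_le:
  fixes m :: int
  assumes "m > 0"
  shows "\<Prod>{p. prime p \<and> p dvd m} \<le> m"
proof -
  have eq: "{p. prime p \<and> p dvd m} = prime_factors m"
    using assms by (auto simp: in_prime_factors_iff)
  have "\<Prod>{p. prime p \<and> p dvd m} \<le> (\<Prod>p\<in>prime_factors m. p ^ multiplicity p m)"
    unfolding eq
  proof (rule prod_mono)
    fix p assume p: "p \<in> prime_factors m"
    hence "p > 0" "multiplicity p m > 0"
      by (auto simp: in_prime_factors_iff prime_gt_0_int prime_multiplicity_gt_zero_iff)
    thus "0 \<le> p \<and> p \<le> p ^ multiplicity p m"
      using self_le_power[of p "multiplicity p m"] by auto
  qed
  also have "\<dots> = m" using assms by (simp add: prod_prime_factors)
  finally show ?thesis .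
qed

text \<open>The power of 2 enters the radical only as a single factor 2, so the radical is below
  \<open>2^(n + 1)\<close>. For \<open>\<kappa> > 1\<close> the exponent
  \<open>1 + \<epsilon>\<close>, halfway between 1 and \<open>\<kappa>\<close>, would admit
  infinitely many such solutions.\<close>

lemma weak_abc_le_1:
  assumes "weak_abc \<kappa>"
  shows "\<kappa> \<le> 1"
proof (rule ccontr)
  assume "\<not> \<kappa> \<le> 1"
  define \<epsilon> where "\<epsilon> = (\<kappa> - 1) / 2"
  have \<epsilon>: "\<epsilon> > 0" "\<kappa> - \<epsilon> = 1 + \<epsilon>" using \<open>\<not> \<kappa> \<le> 1\<close> by (auto simp: \<epsilon>_def field_simps)
  define t where "t = (\<lambda>n::nat. (1 :: int, 2 ^ n - 1 :: int, 2 ^ n :: int))"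
  \<comment> \<open>For \<open>n \<ge> 1 / \<epsilon>\<close> the exponent satisfies
    \<open>1 + n \<le> n * (1 + \<epsilon>)\<close>.\<close>
  define N where "N = nat \<lceil>1 / \<epsilon>\<rceil> + 1"
  define T where "T = {s \<in> primitive_solutions. real_of_int (rad s) \<le> real_of_int (height s) powr (\<kappa> - \<epsilon>)}"
  have "t ` {N..} \<subseteq> T"
  proof (rule image_subsetI)
    fix n assume "n \<in> {N..}"
    hence n: "n \<ge> 1" "real n \<ge> 1 / \<epsilon>" unfolding N_def by (auto, linarith)
    define m where "m = (2 :: int) ^ n"
    have "(2 :: int) ^ 1 \<le> m" unfolding m_def using n by (intro power_increasing) auto
    hence m: "m \<ge> 2" by simp
    have prim: "t n \<in> primitive_solutions"
      using m n by (auto simp: t_def primitive_solutions_def m_def)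
    have height: "height (t n) = m"
      using m by (auto simp: t_def m_def [symmetric])
    have "rad (t n) \<le> 2 * m"
    proof -
      have fin: "finite {p. prime p \<and> p dvd m - 1}"
        using m by (intro finite_prime_divisors) auto
      have "rad (t n) = \<Prod>{p. prime p \<and> p dvd (m - 1) * m}"
        by (simp add: t_def m_def)
      also have "{p. prime p \<and> p dvd (m - 1) * m} = insert 2 {p. prime p \<and> p dvd m - 1}"
        using n by (auto simp: prime_dvd_mult_iff m_def prime_dvd_power_iff primes_dvd_imp_eq)
      also have "\<Prod>(insert 2 {p. prime p \<and> p dvd m - 1}) \<le> 2 * (m - 1)"
      proof -
        have "odd (m - 1)" using n by (auto simp: m_def)
        hence "2 \<notin> {p. prime p \<and> p dvd m - 1}" by simp
        hence "\<Prod>(insert 2 {p. prime p \<and> p dvd m - 1}) = 2 * \<Prod>{p. prime p \<and> p dvd m - 1}"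
          using fin by simp
        thus ?thesis using prod_prime_divisors_le[of "m - 1"] m by simp
      qed
      finally show ?thesis by simp
    qed
    hence "real_of_int (rad (t n)) \<le> real_of_int (2 * m)" by (simp only: of_int_le_iff)
    also have "\<dots> = 2 powr (1 + real n)"
      by (simp add: m_def powr_add powr_realpow)
    also have "\<dots> \<le> 2 powr (real n * (1 + \<epsilon>))"
      using n \<epsilon> by (intro powr_mono) (auto simp: field_simps)
    also have "\<dots> = real_of_int (height (t n)) powr (\<kappa> - \<epsilon>)"
      unfolding height \<epsilon>(2) by (simp add: m_def powr_powr [symmetric] powr_realpow)
    finally show "t n \<in> T" using prim by (simp add: T_def)
  qed
  moreover have "finite T"
    using assms \<epsilon>(1) unfolding weak_abc_def T_def by blast
  moreover have "inj_on t {N..}"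
    by (auto simp: inj_on_def t_def)
  ultimately have "finite {N..}" by (meson finite_imageD finite_subset)
  thus False by (simp add: infinite_Ici)
qed

text \<open>
  The bound \<open>S > (\<kappa> / 2) ln H\<close> only forces the limit inferior to be at least \<open>1\<close>, whence the
  hypothesis \<open>\<kappa> \<le> 1\<close>.
\<close>
lemma smoothness_exponent_ge:
  assumes \<kappa>: "0 < \<kappa>" "\<kappa> \<le> 1"
    and fin: "finite {s \<in> primitive_solutions. real_of_int (smoothness s) \<le> \<kappa> / 2 * ln (real_of_int (height s))}"
  shows "smoothness_exponent \<ge> ereal \<kappa>"
  unfolding smoothness_exponent_def le_Liminf_iff
proof (intro allI impI)
  fix y assume "y < ereal \<kappa>"
  then obtain c where c: "y < ereal c" "c < \<kappa>"
    using ereal_dense2 by (metis ereal_less(1) less_ereal.simps(1))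
  define T where "T = {s \<in> primitive_solutions. real_of_int (smoothness s) \<le> \<kappa> / 2 * ln (real_of_int (height s))}"
  have "bdd_above (height ` T)" using fin by (simp add: T_def)
  then obtain N1 where N1: "\<And>s. s \<in> T \<Longrightarrow> height s \<le> N1" by (auto simp: bdd_above_def)
  \<comment> \<open>Here \<open>c < \<kappa> \<le> 1\<close>, and \<open>ln (ln h)\<close> beyond
    the second argument is equivalent to
    \<open>c * ln (ln h) < ln (\<kappa> / 2) + ln (ln h)\<close>. The 1 keeps the denominator
    \<open>ln (ln h)\<close> positive.\<close>
  define M where "M = max 1 (- ln (\<kappa> / 2) / (1 - c))"
  define N where "N = max (N1 + 1) (\<lceil>exp (exp M)\<rceil> + 1)"
  have "y < ereal (ln (real_of_int (smoothness s)) / ln (ln (real_of_int (height s))))"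
    if s: "height s \<ge> N" "s \<in> primitive_solutions" for s
  proof -
    define h where "h = real_of_int (height s)"
    have "s \<notin> T" using N1[of s] s(1) by (auto simp: N_def)
    hence S: "real_of_int (smoothness s) > \<kappa> / 2 * ln h" using s(2) by (auto simp: T_def h_def)
    have "exp (exp M) < h" using s(1) unfolding N_def h_def by linarith
    hence lnh: "exp M < ln h" by (metis exp_gt_zero exp_less_cancel_iff exp_ln less_trans)
    hence lnlnh: "M < ln (ln h)" by (metis exp_gt_zero exp_less_cancel_iff exp_ln less_trans)
    have lnh0: "ln h > 0" using lnh exp_gt_zero less_trans by blast
    have pos: "ln (ln h) > 0" using lnlnh by (simp add: M_def)
    have "- ln (\<kappa> / 2) / (1 - c) < ln (ln h)" using lnlnh by (simp add: M_def)
    hence "- ln (\<kappa> / 2) < ln (ln h) * (1 - c)"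
      using c \<kappa> by (subst (asm) pos_divide_less_eq) auto
    hence "c * ln (ln h) < ln (\<kappa> / 2) + ln (ln h)" by (simp add: algebra_simps)
    also have "\<dots> = ln (\<kappa> / 2 * ln h)" using \<kappa> lnh0 by (subst ln_mult) auto
    also have "\<dots> < ln (real_of_int (smoothness s))"
      using S \<kappa> lnh0 two_le_smoothness[OF s(2)] by (subst ln_less_cancel_iff) auto
    finally have "c < ln (real_of_int (smoothness s)) / ln (ln h)"
      using pos by (simp add: pos_less_divide_eq)
    thus ?thesis using c(1) unfolding h_def by (metis ereal_less_eq(3) less_le_trans less_imp_le)
  qed
  thus "\<forall>\<^sub>F s in inf (filtercomap height at_top) (principal primitive_solutions).
      y < ereal (ln (real_of_int (smoothness s)) / ln (ln (real_of_int (height s))))"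
    unfolding eventually_inf_principal eventually_filtercomap_at_top_linorder by blast
qed

theorem theorem2p1:
  fixes \<kappa>\<^sub>1 :: real
  assumes "weak_abc \<kappa>\<^sub>1"
  shows "(\<forall>\<epsilon>>0. finite {s \<in> primitive_solutions.
            real_of_int (smoothness s) \<le> (\<kappa>\<^sub>1 - \<epsilon>) * ln (real_of_int (height s))})
         \<and> smoothness_exponent \<ge> ereal \<kappa>\<^sub>1"
proof (intro conjI allI impI)
  fix \<epsilon> :: real assume "\<epsilon> > 0"
  thus "finite {s \<in> primitive_solutions. real_of_int (smoothness s) \<le> (\<kappa>\<^sub>1 - \<epsilon>) * ln (real_of_int (height s))}"
    by (rule finite_smooth_solutions[OF assms])
next
  have pos: "\<kappa>\<^sub>1 > 0" using assms by (simp add: weak_abc_def)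
  \<comment> \<open>Any positive multiple of \<open>ln H\<close> would do here;
    \<open>\<epsilon> = \<kappa>\<^sub>1 / 2\<close> is a convenient choice.\<close>
  hence "finite {s \<in> primitive_solutions. real_of_int (smoothness s) \<le> (\<kappa>\<^sub>1 - \<kappa>\<^sub>1 / 2) * ln (real_of_int (height s))}"
    by (intro finite_smooth_solutions[OF assms]) auto
  thus "smoothness_exponent \<ge> ereal \<kappa>\<^sub>1"
    by (intro smoothness_exponent_ge pos weak_abc_le_1[OF assms]) simp
qed

end
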